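(* Let $\Lambda_{0,0}$ be a smooth Guichard surface, and let $\{\Lambda_{m,n}=f^+_{m,n}\oplus f^-_{m,n}\}_{m,n\ge0}$ be a lattice of Eisenhart transforms of $\Lambda_{0,0}$ (as defined in the context). Then for every $x\in\Sigma^2$ the discrete map $(m,n)\mapsto\Lambda_{m,n}(x)$ is a discrete Guichard surface; that is, discrete Guichard surfaces are obtained as Bianchi quadrilaterals of Eisenhart transformations.
   Context: Ambient space. $\mathbb{R}^{4,2}$ carries the metric $(\cdot,\cdot)$ of signature $(4,2)$ with light cone $\mathcal{L}$; $\mathbb{P}(\mathcal{L})$ is the Lie quadric and $Z$ is the set of lines in it (null $2$-planes of $\mathbb{R}^{4,2}$). $\Sigma^2$ is a simply connected surface; maps $f:\Sigma^2\to\mathbb{P}(\mathcal{L})$ are viewed as null line subbundles and maps $\Lambda:\Sigma^2\to Z$ as rank $2$ null subbundles of $\Sigma^2\times\mathbb{R}^{4,2}$. We identify $\wedge^2\mathbb{R}^{4,2}\cong\mathfrak{o}(4,2)$ via $(u\wedge v)w=(u,w)v-(v,w)u$. For non-orthogonal null lines $a,b$ and $s\in\mathbb{R}\setminus\{0\}$, $\Gamma_a^b(s)$ is the orthogonal map acting as $s$ on $b$, $s^{-1}$ on $a$, and the identity on $(a\oplus b)^\perp$. Isothermic maps. $f:\Sigma^2\to\mathbb{P}(\mathcal{L})$ is isothermic (an isothermic sphere congruence), with associated form $\eta$, if $\eta\in\Omega^1(f\wedge f^\perp)$ is closed and nowhere zero; its connections $\Gamma(t)=d+t\eta$ are flat.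 A Darboux transform of $f$ with parameter $\mu\in\mathbb{R}\setminus\{0\}$ is a map $\hat f$, nowhere orthogonal to $f$, whose line bundle is $\Gamma(\mu)$-parallel; it is isothermic with connections $\hat\Gamma(t)=\Gamma_f^{\hat f}(1-\tfrac t\mu)\circ\Gamma(t)\circ\Gamma_f^{\hat f}(1-\tfrac t\mu)^{-1}$. If $f_j,f_\ell$ are Darboux transforms of $f_i$ with parameters $m_{ij}\ne m_{i\ell}$, Bianchi permutability gives $f_k=\Gamma_{f_i}^{f_j}(1-\tfrac{m_{i\ell}}{m_{ij}})f_\ell=\Gamma_{f_i}^{f_\ell}(1-\tfrac{m_{ij}}{m_{i\ell}})f_j$, simultaneously a Darboux transform of $f_j$ with parameter $m_{i\ell}$ and of $f_\ell$ with parameter $m_{ij}$. A linear conserved quantity of $f$ is $p(t)=p^{(0)}+p^{(1)}t$, $p^{(\iota)}:\Sigma^2\to\mathbb{R}^{4,2}$, with $\Gamma(t)p(t)=0$ for all $t$. $\Omega$-surfaces. Isothermic maps $f^+,f^-$ form an isotropic Darboux pair if there is a section $\tau$ of $f^+\wedge f^-$ with $\Gamma^-(t)=\exp(t\tau)\circ\Gamma^+(t)\circ\exp(-t\tau)$ for all $t$. An $\Omega$-surface is a Legendre immersion $\Lambda=f^+\oplus f^-:\Sigma^2\to Z$ spanned by an isotropic Darboux pair. If $\hat f^+$ is a Darboux transform of $f^+$ with parameter $\mu$, there is a unique $\hat f^-$, namely $\hat f^-=\exp(\mu\tau)\hat f^+$, that is a Darboux transform of $f^-$ with parameter $\mu$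 and forms an isotropic Darboux pair with $\hat f^+$; $\hat\Lambda=\hat f^+\oplus\hat f^-$ is a Lie-Darboux transform of $\Lambda$ with parameter $\mu$. Guichard surfaces and Eisenhart transforms. Guichard surfaces are characterized as the $\Omega$-surfaces for which one of the isothermic sphere congruences, say $f^+$, admits a linear conserved quantity $p(t)$ such that $(p(t),p(t))$ is linear in $t$ with non-zero constant term. Eisenhart transformations of Guichard surfaces are equivalent to the B\"acklund-type Lie-Darboux transformations, i.e. the Lie-Darboux transforms with $p(\mu)\perp\hat f^+$, and the term is used here in that sense; the transform is then equipped with the linear conserved quantity $\hat p(t)=\Gamma_{f^+}^{\hat f^+}(1-\tfrac t\mu)p(t)$ of $\hat f^+$. Lattice. $\Lambda_{m+1,0}$ is an Eisenhart transform of $\Lambda_{m,0}$ with parameter $\alpha_m$, $\Lambda_{0,n+1}$ one of $\Lambda_{0,n}$ with parameter $\beta_n$ (with respect to the successively induced linear conserved quantities), $\alpha_m\ne\beta_n$, and all other $f^\pm_{m,n}$ are determined by Bianchi permutability on elementary quadrilaterals, separately for the $+$ and the $-$ maps. All maps are assumed nondegenerate as needed, in particular $f^\pm_{m,n}$ is nowhere orthogonal to its lattice neighbours of the same sign. Discrete surfaces. Write $i=(m,n)$, $j=(m+1,n)$, $k=(m+1,n+1)$, $\ell=(m,n+1)$. A discrete map $F$ into $\mathbb{P}(\mathcal{L})$ with adjacent values non-orthogonal is discrete isothermic if there is a real non-vanishing edge-labeling with $m_{ij}=m_{\ell k}$, $m_{i\ell}=m_{jk}$ such that $\Gamma(t)_{ji}:=\Gamma_{F_i}^{F_j}(1-\tfrac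 t{m_{ij}})$ satisfies $\Gamma(t)_{kj}\Gamma(t)_{ji}=\Gamma(t)_{k\ell}\Gamma(t)_{\ell i}$ for all $t$ (where defined). Discrete isothermic maps $F^\pm$ with the same edge-labeling form a (discrete) isotropic Darboux pair if there are $\tau_i\in F^+_i\wedge F^-_i$ with $\Gamma^-(t)_{ji}=\exp(t\tau_j)\,\Gamma^+(t)_{ji}\,\exp(-t\tau_i)$ on all edges and all $t$ (where defined). A discrete $\Omega$-surface is a map $i\mapsto F^+_i\oplus F^-_i\in Z$ spanned by a discrete isotropic Darboux pair. It is a discrete Guichard surface if one of $F^\pm$, say $F$, admits a discrete linear conserved quantity $P(t)_i=P^{(0)}_i+P^{(1)}_it$ (i.e. $\Gamma(t)_{ji}P(t)_i=P(t)_j$ on all edges) such that $(P(t)_i,P(t)_i)$ is linear in $t$ with non-zero constant term. *)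

theory Defs
  imports "HOL-Analysis.Analysis"
begin

section \<open>The Lie quadric\<close>

type_synonym R42 = "(real ^ 4) \<times> (real ^ 2)"

definition lie_form :: "R42 \<Rightarrow> R42 \<Rightarrow> real" where
  "lie_form u v = fst u \<bullet> fst v - snd u \<bullet> snd v"

definition orthogonal_spaces :: "R42 set \<Rightarrow> R42 set \<Rightarrow> bool" where
  "orthogonal_spaces a b \<longleftrightarrow> (\<forall>u\<in>a. \<forall>v\<in>b. lie_form u v = 0)"

definition perp :: "R42 set \<Rightarrow> R42 set" where
  "perp a = {v. \<forall>u\<in>a. lie_form u v = 0}"

definition space_sum :: "R42 set \<Rightarrow> R42 set \<Rightarrow> R42 set" where
  "space_sum a b = {u + v | u v. u \<in> a \<and> v \<in> b}"

text \<open>Points of the projectivised light cone are represented by null lines, and elements of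
  \<open>Z\<close> by null 2-planes.  A sum \<open>space_sum a b\<close> of two lines that has dimension 2 is direct.\<close>

definition null_subspaces :: "nat \<Rightarrow> R42 set set" where
  "null_subspaces k = {U. subspace U \<and> dim U = k \<and> orthogonal_spaces U U}"

abbreviation lie_quadric :: "R42 set set" where
  "lie_quadric \<equiv> null_subspaces 1"

abbreviation contact_elements :: "R42 set set" where
  "contact_elements \<equiv> null_subspaces 2"

type_synonym R42_op = "R42 \<Rightarrow>\<^sub>L R42"

definition wedge :: "R42 \<Rightarrow> R42 \<Rightarrow> R42_op" where
  "wedge u v = Blinfun (\<lambda>w. lie_form u w *\<^sub>R v - lie_form v w *\<^sub>R u)"

lemma wedge_apply: "blinfun_apply (wedge u v) w = lie_form u w *\<^sub>R v - lie_form v w *\<^sub>R u"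
proof -
  have "bounded_linear (\<lambda>w. lie_form u w *\<^sub>R v - lie_form v w *\<^sub>R u)"
    unfolding lie_form_def by (intro bounded_linear_intros)
  then show ?thesis
    unfolding wedge_def by (simp add: bounded_linear_Blinfun_apply)
qed

definition wedge_space :: "R42 set \<Rightarrow> R42 set \<Rightarrow> R42_op set" where
  "wedge_space a b = span {wedge u v | u v. u \<in> a \<and> v \<in> b}"

definition op_exp :: "R42_op \<Rightarrow> R42_op" where
  "op_exp T = (\<Sum>n. (1 / fact n) *\<^sub>R (((o\<^sub>L) T ^^ n) id_blinfun))"

definition op_inv :: "R42_op \<Rightarrow> R42_op" where
  "op_inv T = (THE S. S o\<^sub>L T = id_blinfun \<and> T o\<^sub>L S = id_blinfun)"

text \<open>\<open>boost a b s\<close> is the orthogonal map \<open>\<Gamma>\<^sub>a\<^sup>b(s)\<close>.  The three conditions determine it uniquely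
  if \<open>a\<close>, \<open>b\<close> are non-orthogonal null lines and \<open>s \<noteq> 0\<close>; it is only meaningful in that case.\<close>

definition boost :: "R42 set \<Rightarrow> R42 set \<Rightarrow> real \<Rightarrow> R42_op" where
  "boost a b s = (THE T :: R42_op.
     (\<forall>v\<in>b. T v = s *\<^sub>R v) \<and> (\<forall>v\<in>a. T v = inverse s *\<^sub>R v) \<and>
     (\<forall>v\<in>perp (space_sum a b). T v = v))"


section \<open>Smooth surfaces\<close>

fun Ck_on :: "nat \<Rightarrow> 'a::euclidean_space set \<Rightarrow> ('a \<Rightarrow> 'b::real_normed_vector) \<Rightarrow> bool" where
  "Ck_on 0 S g \<longleftrightarrow> continuous_on S g"
| "Ck_on (Suc k) S g \<longleftrightarrow> (\<forall>y\<in>S. g differentiable (at y)) \<and>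
     (\<forall>e. Ck_on k S (\<lambda>y. frechet_derivative g (at y) e))"

text \<open>Only used for open \<open>S\<close>.\<close>

definition smooth_on :: "'a::euclidean_space set \<Rightarrow> ('a \<Rightarrow> 'b::real_normed_vector) \<Rightarrow> bool" where
  "smooth_on S g \<longleftrightarrow> (\<forall>k. Ck_on k S g)"

type_synonym 'p chart = "'p set \<times> ('p \<Rightarrow> real ^ 2)"

definition chart_inv :: "'p chart \<Rightarrow> real ^ 2 \<Rightarrow> 'p" where
  "chart_inv c = inv_into (fst c) (snd c)"

text \<open>A smooth atlas turns the (Hausdorff, second countable) space \<open>'p\<close> into a smooth surface.\<close>

definition smooth_atlas :: "('p::{t2_space, second_countable_topology}) chart set \<Rightarrow> bool" where
  "smooth_atlas A \<longleftrightarrow>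
     (\<Union>c\<in>A. fst c) = UNIV \<and>
     (\<forall>c\<in>A. open (fst c) \<and> open (snd c ` fst c) \<and>
        homeomorphism (fst c) (snd c ` fst c) (snd c) (chart_inv c)) \<and>
     (\<forall>c\<in>A. \<forall>d\<in>A. smooth_on (snd c ` (fst c \<inter> fst d)) (snd d \<circ> chart_inv c))"

definition smooth_map ::
  "('p::topological_space) chart set \<Rightarrow> 'p set \<Rightarrow> ('p \<Rightarrow> 'v::real_normed_vector) \<Rightarrow> bool" where
  "smooth_map A W g \<longleftrightarrow> (\<forall>c\<in>A. smooth_on (snd c ` (fst c \<inter> W)) (g \<circ> chart_inv c))"

text \<open>A tangent vector at \<open>x\<close> is represented by its components \<open>X :: real ^ 2\<close> in a chart \<open>c\<close>
  around \<open>x\<close>; \<open>chart_deriv c g x X\<close> is the derivative of \<open>g\<close> in that direction.\<close>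

definition chart_deriv ::
  "'p chart \<Rightarrow> ('p \<Rightarrow> 'v::real_normed_vector) \<Rightarrow> 'p \<Rightarrow> real ^ 2 \<Rightarrow> 'v" where
  "chart_deriv c g x X = frechet_derivative (g \<circ> chart_inv c) (at (snd c x)) X"

text \<open>Accordingly a 1-form is given by its chart representatives, which have to agree under
  change of coordinates.\<close>

type_synonym ('p, 'v) one_form = "'p chart \<Rightarrow> 'p \<Rightarrow> (real ^ 2) \<Rightarrow>\<^sub>L 'v"

definition smooth_one_form ::
  "('p::topological_space) chart set \<Rightarrow> ('p, 'v::real_normed_vector) one_form \<Rightarrow> bool" where
  "smooth_one_form A \<omega> \<longleftrightarrow>
     (\<forall>c\<in>A. smooth_on (snd c ` fst c) (\<omega> c \<circ> chart_inv c)) \<and>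
     (\<forall>c\<in>A. \<forall>d\<in>A. \<forall>x\<in>fst c \<inter> fst d. \<forall>X.
        blinfun_apply (\<omega> d x) (chart_deriv c (snd d) x X) = blinfun_apply (\<omega> c x) X)"

text \<open>In a chart, \<open>d\<omega>(X,Y) = (D\<^sub>X \<omega>)(Y) - (D\<^sub>Y \<omega>)(X)\<close> for constant \<open>X\<close>, \<open>Y\<close>.\<close>

definition closed_form ::
  "'p chart set \<Rightarrow> ('p, 'v::real_normed_vector) one_form \<Rightarrow> bool" where
  "closed_form A \<omega> \<longleftrightarrow>
     (\<forall>c\<in>A. \<forall>x\<in>fst c. \<forall>X Y.
        blinfun_apply (chart_deriv c (\<omega> c) x X) Y = blinfun_apply (chart_deriv c (\<omega> c) x Y) X)"

definition smooth_subbundle ::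
  "('p::topological_space) chart set \<Rightarrow> nat \<Rightarrow> ('p \<Rightarrow> R42 set) \<Rightarrow> bool" where
  "smooth_subbundle A k B \<longleftrightarrow>
     (\<forall>x. \<exists>W. open W \<and> x \<in> W \<and>
        (\<exists>\<sigma> :: nat \<Rightarrow> 'p \<Rightarrow> R42. (\<forall>i<k. smooth_map A W (\<sigma> i)) \<and>
           (\<forall>y\<in>W. dim (B y) = k \<and> B y = span ((\<lambda>i. \<sigma> i y) ` {..<k}))))"

definition local_section ::
  "('p::topological_space) chart set \<Rightarrow> 'p set \<Rightarrow> ('p \<Rightarrow> R42 set) \<Rightarrow> ('p \<Rightarrow> R42) \<Rightarrow> bool" where
  "local_section A W B v \<longleftrightarrow> open W \<and> smooth_map A W v \<and> (\<forall>y\<in>W. v y \<in> B y)"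

text \<open>A map into \<open>\<P>(\<L>)\<close> is the same as a null line subbundle.\<close>

definition sphere_congruence ::
  "('p::topological_space) chart set \<Rightarrow> ('p \<Rightarrow> R42 set) \<Rightarrow> bool" where
  "sphere_congruence A f \<longleftrightarrow> smooth_subbundle A 1 f \<and> (\<forall>x. f x \<in> lie_quadric)"

text \<open>The usual notion of a Legendre immersion: the contact condition, and the requirement that
  no nonzero tangent vector differentiates all sections of \<open>L\<close> into \<open>L\<close>.\<close>

definition legendre_immersion ::
  "('p::topological_space) chart set \<Rightarrow> ('p \<Rightarrow> R42 set) \<Rightarrow> bool" where
  "legendre_immersion A L \<longleftrightarrow>
     smooth_subbundle A 2 L \<and> (\<forall>x. L x \<in> contact_elements) \<and>
     (\<forall>W u v. local_section A W L u \<and> local_section A W L v \<longrightarrow>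
        (\<forall>c\<in>A. \<forall>x\<in>fst c \<inter> W. \<forall>X. lie_form (chart_deriv c u x X) (v x) = 0)) \<and>
     (\<forall>c\<in>A. \<forall>x\<in>fst c. \<forall>X.
        (\<forall>W u. x \<in> W \<and> local_section A W L u \<longrightarrow> chart_deriv c u x X \<in> L x) \<longrightarrow> X = 0)"


section \<open>Isothermic maps and their Darboux transforms\<close>

text \<open>The connection \<open>\<Gamma>(t) = d + t\<eta>\<close>, applied to a vector field \<open>v\<close>.\<close>

definition conn ::
  "('p, R42_op) one_form \<Rightarrow> real \<Rightarrow> ('p \<Rightarrow> R42) \<Rightarrow> 'p chart \<Rightarrow> 'p \<Rightarrow> real ^ 2 \<Rightarrow> R42" where
  "conn \<eta> t v c x X = chart_deriv c v x X + t *\<^sub>R blinfun_apply (blinfun_apply (\<eta> c x) X) (v x)"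

text \<open>\<open>conn_gauge A g h \<eta> \<eta>' t\<close> says \<open>\<Gamma>'(t) = g \<circ> \<Gamma>(t) \<circ> h\<close>, as operators on (local) sections of the
  trivial bundle.\<close>

definition conn_gauge ::
  "('p::topological_space) chart set \<Rightarrow> ('p \<Rightarrow> R42_op) \<Rightarrow> ('p \<Rightarrow> R42_op) \<Rightarrow>
   ('p, R42_op) one_form \<Rightarrow> ('p, R42_op) one_form \<Rightarrow> real \<Rightarrow> bool" where
  "conn_gauge A g h \<eta> \<eta>' t \<longleftrightarrow>
     (\<forall>W v. open W \<and> smooth_map A W v \<longrightarrow>
        (\<forall>c\<in>A. \<forall>x\<in>fst c \<inter> W. \<forall>X.
           conn \<eta>' t v c x X =
             blinfun_apply (g x) (conn \<eta> t (\<lambda>y. blinfun_apply (h y) (v y)) c x X)))"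

definition isothermic ::
  "('p::topological_space) chart set \<Rightarrow> ('p \<Rightarrow> R42 set) \<Rightarrow> ('p, R42_op) one_form \<Rightarrow> bool" where
  "isothermic A f \<eta> \<longleftrightarrow>
     sphere_congruence A f \<and> smooth_one_form A \<eta> \<and> closed_form A \<eta> \<and>
     (\<forall>c\<in>A. \<forall>x\<in>fst c. \<eta> c x \<noteq> 0 \<and>
        (\<forall>X. blinfun_apply (\<eta> c x) X \<in> wedge_space (f x) (perp (f x))))"

definition parallel_bundle ::
  "('p::topological_space) chart set \<Rightarrow> ('p, R42_op) one_form \<Rightarrow> real \<Rightarrow> ('p \<Rightarrow> R42 set) \<Rightarrow> bool" where
  "parallel_bundle A \<eta> t B \<longleftrightarrow>
     (\<forall>W v. local_section A W B v \<longrightarrow>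
        (\<forall>c\<in>A. \<forall>x\<in>fst c \<inter> W. \<forall>X. conn \<eta> t v c x X \<in> B x))"

text \<open>The last condition fixes the form \<open>\<eta>'\<close> with which the transform is again isothermic.\<close>

definition darboux_transform ::
  "('p::topological_space) chart set \<Rightarrow> real \<Rightarrow> ('p \<Rightarrow> R42 set) \<Rightarrow> ('p, R42_op) one_form \<Rightarrow>
   ('p \<Rightarrow> R42 set) \<Rightarrow> ('p, R42_op) one_form \<Rightarrow> bool" where
  "darboux_transform A \<mu> f \<eta> f' \<eta>' \<longleftrightarrow>
     \<mu> \<noteq> 0 \<and> sphere_congruence A f' \<and> (\<forall>x. \<not> orthogonal_spaces (f x) (f' x)) \<and>
     parallel_bundle A \<eta> \<mu> f' \<and>
     (\<forall>t. t \<noteq> \<mu> \<longrightarrow>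
        conn_gauge A (\<lambda>x. boost (f x) (f' x) (1 - t / \<mu>))
          (\<lambda>x. op_inv (boost (f x) (f' x) (1 - t / \<mu>))) \<eta> \<eta>' t)"

definition linear_conserved_quantity ::
  "('p::topological_space) chart set \<Rightarrow> ('p, R42_op) one_form \<Rightarrow> ('p \<Rightarrow> R42) \<Rightarrow> ('p \<Rightarrow> R42) \<Rightarrow> bool" where
  "linear_conserved_quantity A \<eta> p0 p1 \<longleftrightarrow>
     smooth_map A UNIV p0 \<and> smooth_map A UNIV p1 \<and>
     (\<forall>t. \<forall>c\<in>A. \<forall>x\<in>fst c. \<forall>X. conn \<eta> t (\<lambda>y. p0 y + t *\<^sub>R p1 y) c x X = 0)"


section \<open>Omega surfaces, Guichard surfaces and Eisenhart transforms\<close>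

definition isotropic_pair_via ::
  "('p::topological_space) chart set \<Rightarrow> ('p \<Rightarrow> R42_op) \<Rightarrow>
   ('p \<Rightarrow> R42 set) \<Rightarrow> ('p, R42_op) one_form \<Rightarrow> ('p \<Rightarrow> R42 set) \<Rightarrow> ('p, R42_op) one_form \<Rightarrow> bool" where
  "isotropic_pair_via A \<tau> fp \<eta>p fm \<eta>m \<longleftrightarrow>
     isothermic A fp \<eta>p \<and> isothermic A fm \<eta>m \<and>
     smooth_map A UNIV \<tau> \<and> (\<forall>x. \<tau> x \<in> wedge_space (fp x) (fm x)) \<and>
     (\<forall>t. conn_gauge A (\<lambda>x. op_exp (t *\<^sub>R \<tau> x)) (\<lambda>x. op_exp ((- t) *\<^sub>R \<tau> x)) \<eta>p \<eta>m t)"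

text \<open>The fields \<open>cq0\<close>, \<open>cq1\<close> are the coefficients of a linear conserved quantity of the
  sphere congruence \<open>sph_p\<close>; they play no role for an Omega surface as such.\<close>

record 'p surface_data =
  sph_p :: "'p \<Rightarrow> R42 set"
  form_p :: "('p, R42_op) one_form"
  sph_m :: "'p \<Rightarrow> R42 set"
  form_m :: "('p, R42_op) one_form"
  cq0 :: "'p \<Rightarrow> R42"
  cq1 :: "'p \<Rightarrow> R42"

definition cq :: "'p surface_data \<Rightarrow> real \<Rightarrow> 'p \<Rightarrow> R42" where
  "cq S t x = cq0 S x + t *\<^sub>R cq1 S x"

definition omega_surface :: "('p::topological_space) chart set \<Rightarrow> 'p surface_data \<Rightarrow> bool" where
  "omega_surface A S \<longleftrightarrow>
     (\<exists>\<tau>. isotropic_pair_via A \<tau> (sph_p S) (form_p S) (sph_m S) (form_m S)) \<and>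
     legendre_immersion A (\<lambda>x. space_sum (sph_p S x) (sph_m S x))"

text \<open>A linear polynomial is a polynomial of degree 1.  (If \<open>(p(t), p(t))\<close> is a nonzero constant,
  the surface is isothermic rather than Guichard.)\<close>

definition guichard_surface :: "('p::topological_space) chart set \<Rightarrow> 'p surface_data \<Rightarrow> bool" where
  "guichard_surface A S \<longleftrightarrow>
     omega_surface A S \<and> linear_conserved_quantity A (form_p S) (cq0 S) (cq1 S) \<and>
     (\<exists>a b. a \<noteq> 0 \<and> b \<noteq> 0 \<and> (\<forall>x t. lie_form (cq S t x) (cq S t x) = a + b * t))"

definition lie_darboux_transform ::
  "('p::topological_space) chart set \<Rightarrow> real \<Rightarrow> 'p surface_data \<Rightarrow> 'p surface_data \<Rightarrow> bool" where
  "lie_darboux_transform A \<mu> S S' \<longleftrightarrow>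
     omega_surface A S' \<and>
     darboux_transform A \<mu> (sph_p S) (form_p S) (sph_p S') (form_p S') \<and>
     darboux_transform A \<mu> (sph_m S) (form_m S) (sph_m S') (form_m S') \<and>
     (\<exists>\<tau>. isotropic_pair_via A \<tau> (sph_p S) (form_p S) (sph_m S) (form_m S) \<and>
        (\<forall>x. sph_m S' x = blinfun_apply (op_exp (\<mu> *\<^sub>R \<tau> x)) ` sph_p S' x))"

definition eisenhart_transform ::
  "('p::topological_space) chart set \<Rightarrow> real \<Rightarrow> 'p surface_data \<Rightarrow> 'p surface_data \<Rightarrow> bool" where
  "eisenhart_transform A \<mu> S S' \<longleftrightarrow>
     lie_darboux_transform A \<mu> S S' \<and>
     (\<forall>x. orthogonal_spaces {cq S \<mu> x} (sph_p S' x)) \<and>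
     (\<forall>t x. t \<noteq> \<mu> \<longrightarrow>
        cq S' t x = blinfun_apply (boost (sph_p S x) (sph_p S' x) (1 - t / \<mu>)) (cq S t x))"

text \<open>Completing an elementary quadrilateral \<open>(i, j, k, l)\<close> by Bianchi permutability, with
  parameters \<open>m\<^sub>i\<^sub>j\<close> and \<open>m\<^sub>i\<^sub>l\<close> on the edges at \<open>i\<close>.\<close>

definition bianchi :: "real \<Rightarrow> real \<Rightarrow> R42 set \<Rightarrow> R42 set \<Rightarrow> R42 set \<Rightarrow> R42 set" where
  "bianchi mij mil fi fj fl = blinfun_apply (boost fi fj (1 - mil / mij)) ` fl"

definition bianchi_lattice ::
  "(nat \<Rightarrow> real) \<Rightarrow> (nat \<Rightarrow> real) \<Rightarrow> (nat \<Rightarrow> nat \<Rightarrow> 'p \<Rightarrow> R42 set) \<Rightarrow> bool" where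
  "bianchi_lattice \<alpha> \<beta> f \<longleftrightarrow>
     (\<forall>m n x. \<not> orthogonal_spaces (f m n x) (f (Suc m) n x) \<and>
              \<not> orthogonal_spaces (f m n x) (f m (Suc n) x)) \<and>
     (\<forall>m n x. f (Suc m) (Suc n) x =
        bianchi (\<alpha> m) (\<beta> n) (f m n x) (f (Suc m) n x) (f m (Suc n) x))"

text \<open>\<open>H m\<close> and \<open>V n\<close> are the surfaces \<open>\<Lambda>\<^sub>m\<^sub>,\<^sub>0\<close> and \<open>\<Lambda>\<^sub>0\<^sub>,\<^sub>n\<close> along the two axes, \<open>fp m n\<close> and \<open>fm m n\<close>
  are \<open>f\<^sup>\<plusminus>\<^sub>m\<^sub>,\<^sub>n\<close>.\<close>

definition eisenhart_lattice ::
  "('p::topological_space) chart set \<Rightarrow> (nat \<Rightarrow> real) \<Rightarrow> (nat \<Rightarrow> real) \<Rightarrow> 'p surface_data \<Rightarrow>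
   (nat \<Rightarrow> nat \<Rightarrow> 'p \<Rightarrow> R42 set) \<Rightarrow> (nat \<Rightarrow> nat \<Rightarrow> 'p \<Rightarrow> R42 set) \<Rightarrow> bool" where
  "eisenhart_lattice A \<alpha> \<beta> S fp fm \<longleftrightarrow>
     (\<exists>H V. H 0 = S \<and> V 0 = S \<and>
        (\<forall>m. eisenhart_transform A (\<alpha> m) (H m) (H (Suc m))) \<and>
        (\<forall>n. eisenhart_transform A (\<beta> n) (V n) (V (Suc n))) \<and>
        (\<forall>m. fp m 0 = sph_p (H m) \<and> fm m 0 = sph_m (H m)) \<and>
        (\<forall>n. fp 0 n = sph_p (V n) \<and> fm 0 n = sph_m (V n))) \<and>
     (\<forall>m n. \<alpha> m \<noteq> \<beta> n) \<and>
     bianchi_lattice \<alpha> \<beta> fp \<and> bianchi_lattice \<alpha> \<beta> fm"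


section \<open>Discrete surfaces\<close>

text \<open>An edge labelling is given by \<open>a m n\<close> on the edge from \<open>(m, n)\<close> to \<open>(m + 1, n)\<close> and \<open>b m n\<close> on
  the edge from \<open>(m, n)\<close> to \<open>(m, n + 1)\<close>.\<close>

type_synonym labels = "nat \<Rightarrow> nat \<Rightarrow> real"

definition edge_labelling :: "labels \<Rightarrow> labels \<Rightarrow> bool" where
  "edge_labelling a b \<longleftrightarrow>
     (\<forall>m n. a m n \<noteq> 0 \<and> b m n \<noteq> 0 \<and> a m (Suc n) = a m n \<and> b (Suc m) n = b m n)"

definition conn_h :: "labels \<Rightarrow> (nat \<Rightarrow> nat \<Rightarrow> R42 set) \<Rightarrow> real \<Rightarrow> nat \<Rightarrow> nat \<Rightarrow> R42_op" where
  "conn_h a F t m n = boost (F m n) (F (Suc m) n) (1 - t / a m n)"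

definition conn_v :: "labels \<Rightarrow> (nat \<Rightarrow> nat \<Rightarrow> R42 set) \<Rightarrow> real \<Rightarrow> nat \<Rightarrow> nat \<Rightarrow> R42_op" where
  "conn_v b F t m n = boost (F m n) (F m (Suc n)) (1 - t / b m n)"

definition discrete_isothermic ::
  "labels \<Rightarrow> labels \<Rightarrow> (nat \<Rightarrow> nat \<Rightarrow> R42 set) \<Rightarrow> bool" where
  "discrete_isothermic a b F \<longleftrightarrow>
     edge_labelling a b \<and>
     (\<forall>m n. F m n \<in> lie_quadric \<and>
        \<not> orthogonal_spaces (F m n) (F (Suc m) n) \<and> \<not> orthogonal_spaces (F m n) (F m (Suc n))) \<and>
     (\<forall>m n t. t \<noteq> a m n \<and> t \<noteq> b m n \<longrightarrow>
        conn_v b F t (Suc m) n o\<^sub>L conn_h a F t m n = conn_h a F t m (Suc n) o\<^sub>L conn_v b F t m n)"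

definition discrete_isotropic_pair ::
  "labels \<Rightarrow> labels \<Rightarrow> (nat \<Rightarrow> nat \<Rightarrow> R42 set) \<Rightarrow> (nat \<Rightarrow> nat \<Rightarrow> R42 set) \<Rightarrow> bool" where
  "discrete_isotropic_pair a b Fp Fm \<longleftrightarrow>
     discrete_isothermic a b Fp \<and> discrete_isothermic a b Fm \<and>
     (\<exists>\<tau>. (\<forall>m n. \<tau> m n \<in> wedge_space (Fp m n) (Fm m n)) \<and>
        (\<forall>m n t. t \<noteq> a m n \<longrightarrow> conn_h a Fm t m n =
           op_exp (t *\<^sub>R \<tau> (Suc m) n) o\<^sub>L conn_h a Fp t m n o\<^sub>L op_exp ((- t) *\<^sub>R \<tau> m n)) \<and>
        (\<forall>m n t. t \<noteq> b m n \<longrightarrow> conn_v b Fm t m n =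
           op_exp (t *\<^sub>R \<tau> m (Suc n)) o\<^sub>L conn_v b Fp t m n o\<^sub>L op_exp ((- t) *\<^sub>R \<tau> m n)))"

definition discrete_omega_surface_via ::
  "labels \<Rightarrow> labels \<Rightarrow> (nat \<Rightarrow> nat \<Rightarrow> R42 set) \<Rightarrow> (nat \<Rightarrow> nat \<Rightarrow> R42 set) \<Rightarrow>
   (nat \<Rightarrow> nat \<Rightarrow> R42 set) \<Rightarrow> bool" where
  "discrete_omega_surface_via a b Fp Fm L \<longleftrightarrow>
     discrete_isotropic_pair a b Fp Fm \<and>
     (\<forall>m n. L m n = space_sum (Fp m n) (Fm m n) \<and> L m n \<in> contact_elements)"

definition discrete_linear_conserved_quantity ::
  "labels \<Rightarrow> labels \<Rightarrow> (nat \<Rightarrow> nat \<Rightarrow> R42 set) \<Rightarrow>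
   (nat \<Rightarrow> nat \<Rightarrow> R42) \<Rightarrow> (nat \<Rightarrow> nat \<Rightarrow> R42) \<Rightarrow> bool" where
  "discrete_linear_conserved_quantity a b F P0 P1 \<longleftrightarrow>
     (\<forall>m n t. t \<noteq> a m n \<longrightarrow>
        blinfun_apply (conn_h a F t m n) (P0 m n + t *\<^sub>R P1 m n) = P0 (Suc m) n + t *\<^sub>R P1 (Suc m) n) \<and>
     (\<forall>m n t. t \<noteq> b m n \<longrightarrow>
        blinfun_apply (conn_v b F t m n) (P0 m n + t *\<^sub>R P1 m n) = P0 m (Suc n) + t *\<^sub>R P1 m (Suc n))"

definition guichard_quantity_for ::
  "labels \<Rightarrow> labels \<Rightarrow> (nat \<Rightarrow> nat \<Rightarrow> R42 set) \<Rightarrow> bool" where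
  "guichard_quantity_for a b F \<longleftrightarrow>
     (\<exists>P0 P1. discrete_linear_conserved_quantity a b F P0 P1 \<and>
        (\<exists>r s. r \<noteq> 0 \<and> s \<noteq> 0 \<and>
           (\<forall>m n t. lie_form (P0 m n + t *\<^sub>R P1 m n) (P0 m n + t *\<^sub>R P1 m n) = r + s * t)))"

definition discrete_guichard_surface :: "(nat \<Rightarrow> nat \<Rightarrow> R42 set) \<Rightarrow> bool" where
  "discrete_guichard_surface L \<longleftrightarrow>
     (\<exists>a b Fp Fm. discrete_omega_surface_via a b Fp Fm L \<and>
        (guichard_quantity_for a b Fp \<or> guichard_quantity_for a b Fm))"

end

theory Submission
  imports Defs
begin

text \<open>
Fix a point of the surface.  To two non-orthogonal null lines \<open>a\<close>, \<open>b\<close> belongs the normalised wedge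
\<open>N(a, b) = (u \<and> v) / (u, v)\<close> with \<open>u\<close> in \<open>a\<close> and \<open>v\<close> in \<open>b\<close>; it is the generator of the boosts
\<open>\<Gamma>\<^sub>a\<^sup>b(s)\<close>.  The proof rests on the observation that everything the theorem asks for is controlled by
the discrete one-form that assigns \<open>N / m\<close> to an edge with parameter \<open>m\<close>.

For a single edge two algebraic facts hold.  If \<open>\<tau>\<close> belongs to an isotropic pair \<open>f\<^sup>+, f\<^sup>-\<close> and the
neighbours are related by \<open>exp (m \<tau>)\<close>, then \<open>\<tau> + (N\<^sup>+ - N\<^sup>-) / m\<close> belongs to the pair of neighbours
and the exponentials intertwine the two discrete connections (\<open>isotropic_section_transfer\<close>).  If \<open>p + t q\<close>
is a polynomial with \<open>q\<close> orthogonal to \<open>f\<close> and \<open>p + m q\<close> orthogonal to the neighbour of \<open>f\<close>, then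
the connection maps it to the polynomial \<open>p + t (q - N p / m)\<close>, with the same orthogonality and the
same norm (\<open>conserved_quantity_transfer\<close>).  For a Bianchi quadrilateral the discrete connection is
flat, and the one-form \<open>N / m\<close> is closed (\<open>bianchi_quad\<close>).  Hence it has a potential \<open>\<Phi>\<close> on the lattice,
and there is no choice left: \<open>\<tau>\<close> must be \<open>\<tau>\<^sub>0\<^sub>0 + \<Phi>\<^sup>+ - \<Phi>\<^sup>-\<close>, and the conserved quantity must be
\<open>p + t (q - \<Phi>\<^sup>+ p)\<close>.  The incidences that the edge lemmas require are propagated from the axes into
the lattice by the boosts of each quadrilateral (\<open>lattice_induct\<close>).

What remains is that on the axes the smooth data are the ones given by \<open>\<Phi>\<close>.  For the conserved
quantity this is algebra, given that \<open>p\<^sup>(\<^sup>1\<^sup>)\<close> is orthogonal to \<open>f\<close>.  For \<open>\<tau>\<close> it is the one place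
where analysis enters: each transform along an axis comes with its own \<open>\<tau>\<close>, related to the next one
only through the connections.  Comparing coefficients of \<open>t\<close> in the gauge relations gives
\<open>\<eta>\<^sup>- = \<eta>\<^sup>+ - d\<tau>\<close> for an isotropic pair and \<open>\<eta>' = \<eta> + dN / m\<close> for a Darboux transform, so that \<open>\<tau>'\<close> and
\<open>\<tau> + (N\<^sup>+ - N\<^sup>-) / m\<close> have the same differential.  Their difference is a constant section of the line
bundle \<open>f\<^sup>+ \<and> f\<^sup>-\<close> of the transform; were it nonzero, the contact elements \<open>f\<^sup>+ \<oplus> f\<^sup>-\<close>, being the range of this section, would be
constant, which is impossible for an immersion (\<open>isotropic_gauge_unique\<close>).
\<close>

section \<open>Null lines, boosts and normalised wedges\<close>

lemma bounded_bilinear_lie_form: "bounded_bilinear lie_form"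
proof
  show "\<exists>K. \<forall>u v. norm (lie_form u v) \<le> norm u * norm v * K"
  proof (intro exI allI)
    fix u v :: R42
    have "\<bar>fst u \<bullet> fst v\<bar> \<le> norm u * norm v"
      by (rule order_trans[OF Cauchy_Schwarz_ineq2]) (metis mult_mono norm_fst_le norm_ge_zero prod.collapse)
    moreover have "\<bar>snd u \<bullet> snd v\<bar> \<le> norm u * norm v"
      by (rule order_trans[OF Cauchy_Schwarz_ineq2]) (metis mult_mono norm_snd_le norm_ge_zero prod.collapse)
    ultimately show "norm (lie_form u v) \<le> norm u * norm v * 2"
      by (simp add: lie_form_def)
  qed
qed (simp_all add: lie_form_def inner_simps right_diff_distrib)

interpretation lie_form: bounded_bilinear lie_form
  by (rule bounded_bilinear_lie_form)

lemma lie_form_commute: "lie_form u v = lie_form v u"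
  by (simp add: lie_form_def inner_commute)

lemmas lie_form_simps =
  lie_form.add_left lie_form.add_right lie_form.diff_left lie_form.diff_right
  lie_form.minus_left lie_form.minus_right lie_form.zero_left lie_form.zero_right
  lie_form.scaleR_left lie_form.scaleR_right

text \<open>With these rank-one maps a wedge and a boost become explicit bilinear expressions in generators
of the lines, which can be differentiated.\<close>

definition lie_tensor :: "R42 \<Rightarrow> R42 \<Rightarrow> R42_op" where
  "lie_tensor u v = Blinfun (\<lambda>w. lie_form u w *\<^sub>R v)"

lemma lie_tensor_apply: "blinfun_apply (lie_tensor u v) w = lie_form u w *\<^sub>R v"
proof -
  have "bounded_linear (\<lambda>w. lie_form u w *\<^sub>R v)"
    by (rule bounded_linear_compose[OF bounded_linear_scaleR_left lie_form.bounded_linear_right])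
  then show ?thesis
    unfolding lie_tensor_def by (simp add: bounded_linear_Blinfun_apply)
qed

lemma wedge_eq_lie_tensor: "wedge u v = lie_tensor u v - lie_tensor v u"
  by (rule blinfun_eqI) (simp add: wedge_apply lie_tensor_apply blinfun.diff_left)

lemma bounded_bilinear_lie_tensor: "bounded_bilinear lie_tensor"
proof
  show "\<exists>K. \<forall>a b. norm (lie_tensor a b) \<le> norm a * norm b * K"
  proof -
    obtain K where K: "K \<ge> 0" "\<And>u v. norm (lie_form u v) \<le> norm u * norm v * K"
      using lie_form.nonneg_bounded by blast
    have "norm (lie_tensor a b) \<le> norm a * norm b * K" for a b
    proof (rule norm_blinfun_bound)
      show "0 \<le> norm a * norm b * K" using K by simp
      fix w
      have "norm (lie_form a w) * norm b \<le> norm a * norm w * K * norm b"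
        by (rule mult_right_mono) (use K in auto)
      then show "norm (blinfun_apply (lie_tensor a b) w) \<le> norm a * norm b * K * norm w"
        by (simp add: lie_tensor_apply mult_ac)
    qed
    then show ?thesis by blast
  qed
qed (rule blinfun_eqI; simp add: lie_tensor_apply blinfun.add_left blinfun.scaleR_left
      lie_form_simps scaleR_add_left scaleR_add_right mult.commute)+

interpretation lie_tensor: bounded_bilinear lie_tensor
  by (rule bounded_bilinear_lie_tensor)

lemma lie_quadricE:
  assumes "a \<in> lie_quadric"
  obtains u where "u \<noteq> 0" "a = span {u}" "lie_form u u = 0"
proof -
  have a: "subspace a" "dim a = 1" "orthogonal_spaces a a"
    using assms by (auto simp: null_subspaces_def)
  obtain B where B: "B \<subseteq> a" "independent B" "a \<subseteq> span B" "card B = dim a"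
    using basis_exists by blast
  then have "card B = 1"
    using a by simp
  then obtain u where u: "B = {u}"
    by (rule card_1_singletonE)
  have "a = span {u}"
    using B(3) span_minimal[OF B(1) a(1)] u by simp
  moreover have "u \<noteq> 0"
    using B(2) u by auto
  moreover have "lie_form u u = 0"
    using a(3) B(1) u by (auto simp: orthogonal_spaces_def)
  ultimately show ?thesis
    using that by blast
qed

lemma span_singleton_lie_quadric:
  assumes "u \<noteq> 0" "lie_form u u = 0"
  shows "span {u} \<in> lie_quadric"
proof -
  have "orthogonal_spaces (span {u}) (span {u})"
    using assms by (auto simp: orthogonal_spaces_def span_singleton lie_form_simps)
  then show ?thesis
    using assms by (simp add: null_subspaces_def dim_singleton)
qed

lemma orthogonal_spaces_span_singleton:
  "orthogonal_spaces (span {u}) (span {v}) \<longleftrightarrow> lie_form u v = 0"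
  by (auto simp: orthogonal_spaces_def span_singleton lie_form_simps)

lemma span_singleton_scaleR:
  assumes "c \<noteq> 0"
  shows "span {c *\<^sub>R u} = span {u :: 'a :: real_vector}"
proof -
  have "x \<in> range (\<lambda>k. k *\<^sub>R c *\<^sub>R u)" if "x = k *\<^sub>R u" for x k
    using assms that by (intro image_eqI[where x = "k / c"]) auto
  then show ?thesis
    by (auto simp: span_singleton)
qed

lemma nonorthogonal_linesE:
  assumes "span {u} \<in> lie_quadric" "b \<in> lie_quadric" "\<not> orthogonal_spaces (span {u}) b"
  obtains v where "b = span {v}" "lie_form u v = 1" "lie_form v v = 0"
proof -
  obtain v where v: "v \<noteq> 0" "b = span {v}" "lie_form v v = 0"
    using assms(2) by (rule lie_quadricE)
  have uv: "lie_form u v \<noteq> 0"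
    using assms(3) by (simp add: v orthogonal_spaces_span_singleton)
  show ?thesis
    using that[of "(1 / lie_form u v) *\<^sub>R v"] uv v
    by (simp add: span_singleton_scaleR lie_form_simps)
qed

definition boost_map :: "R42 \<Rightarrow> R42 \<Rightarrow> real \<Rightarrow> R42_op" where
  "boost_map u v s = id_blinfun + ((s - 1) / lie_form u v) *\<^sub>R lie_tensor u v
     + ((inverse s - 1) / lie_form u v) *\<^sub>R lie_tensor v u"

lemma boost_map_apply:
  "blinfun_apply (boost_map u v s) w = w + ((s - 1) / lie_form u v * lie_form u w) *\<^sub>R v
     + ((inverse s - 1) / lie_form u v * lie_form v w) *\<^sub>R u"
  by (simp add: boost_map_def lie_tensor_apply blinfun.add_left blinfun.scaleR_left)

text \<open>Non-orthogonality splits every vector into parts in the two lines and in the orthogonal complement of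
both, so the three conditions that describe a boost determine it.\<close>

lemma boost_span:
  assumes "lie_form u u = 0" "lie_form v v = 0" "lie_form u v \<noteq> 0"
  shows "boost (span {u}) (span {v}) s = boost_map u v s"
  unfolding boost_def
proof (rule the_equality)
  have "lie_form u w = 0 \<and> lie_form v w = 0" if "w \<in> perp (space_sum (span {u}) (span {v}))" for w
  proof -
    have "u \<in> space_sum (span {u}) (span {v})" "v \<in> space_sum (span {u}) (span {v})"
      unfolding space_sum_def
      by (rule CollectI, rule exI[of _ u], rule exI[of _ 0], simp add: span_base span_zero,
          rule CollectI, rule exI[of _ 0], rule exI[of _ v], simp add: span_base span_zero)
    then show ?thesis
      using that by (auto simp: perp_def)
  qed
  then show "(\<forall>w\<in>span {v}. blinfun_apply (boost_map u v s) w = s *\<^sub>R w) \<and>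
    (\<forall>w\<in>span {u}. blinfun_apply (boost_map u v s) w = inverse s *\<^sub>R w) \<and>
    (\<forall>w\<in>perp (space_sum (span {u}) (span {v})). blinfun_apply (boost_map u v s) w = w)"
    using assms
    by (auto simp: boost_map_def span_singleton lie_tensor_apply blinfun.add_left blinfun.scaleR_left
        lie_form_simps lie_form_commute[of v u] simp flip: scaleR_add_left scaleR_left_distrib)
       (simp_all add: algebra_simps)
next
  fix T :: R42_op
  assume T: "(\<forall>w\<in>span {v}. blinfun_apply T w = s *\<^sub>R w) \<and>
    (\<forall>w\<in>span {u}. blinfun_apply T w = inverse s *\<^sub>R w) \<and>
    (\<forall>w\<in>perp (space_sum (span {u}) (span {v})). blinfun_apply T w = w)"
  show "T = boost_map u v s"
  proof (rule blinfun_eqI)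
    fix w
    define p where "p = lie_form u w / lie_form u v"
    define q where "q = lie_form v w / lie_form u v"
    define z where "z = w - p *\<^sub>R v - q *\<^sub>R u"
    have "lie_form u z = 0" "lie_form v z = 0"
      using assms by (simp_all add: z_def p_def q_def lie_form_simps lie_form_commute[of v u])
    then have "lie_form (p *\<^sub>R u + q *\<^sub>R v) z = 0" for p q
      by (simp add: lie_form_simps)
    then have "z \<in> perp (space_sum (span {u}) (span {v}))"
      unfolding perp_def space_sum_def span_singleton by blast
    then have "blinfun_apply T z = z"
      using T by blast
    moreover have "blinfun_apply T v = s *\<^sub>R v" "blinfun_apply T u = inverse s *\<^sub>R u"
      using T by (auto simp: span_base)
    moreover have "w = z + p *\<^sub>R v + q *\<^sub>R u"
      by (simp add: z_def)
    ultimately have "blinfun_apply T w = z + (p * s) *\<^sub>R v + (q * inverse s) *\<^sub>R u"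
      by (simp add: blinfun.add_right blinfun.scaleR_right)
    also have "\<dots> = blinfun_apply (boost_map u v s) w"
      by (simp add: boost_map_apply z_def p_def q_def algebra_simps add_divide_distrib
          diff_divide_distrib)
    finally show "blinfun_apply T w = blinfun_apply (boost_map u v s) w" .
  qed
qed

text \<open>Identities between linear combinations of vectors are reduced to identities between real
  numbers by pairing them with an arbitrary vector.\<close>

lemma vector_eqI_inner:
  fixes p q :: "'a::real_inner"
  assumes "\<And>z. p \<bullet> z = q \<bullet> z"
  shows "p = q"
  using assms vector_eq_rdot by blast

lemma lie_form_boost_map:
  assumes "lie_form u u = 0" "lie_form v v = 0" "lie_form u v \<noteq> 0" "s \<noteq> 0"
  shows "lie_form (blinfun_apply (boost_map u v s) w) (blinfun_apply (boost_map u v s) z) = lie_form w z"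
  using assms
  by (simp add: boost_map_apply lie_form_simps lie_form_commute[of v u] lie_form_commute[of w u]
        lie_form_commute[of w v]) (simp add: field_simps)

lemma boost_map_inverse:
  assumes "lie_form u u = 0" "lie_form v v = 0" "lie_form u v \<noteq> 0" "s \<noteq> 0"
  shows "boost_map u v s o\<^sub>L boost_map u v (inverse s) = id_blinfun"
proof (rule blinfun_eqI, rule vector_eqI_inner)
  fix w z
  show "blinfun_apply (boost_map u v s o\<^sub>L boost_map u v (inverse s)) w \<bullet> z =
      blinfun_apply id_blinfun w \<bullet> z"
    using assms
    by (simp add: boost_map_apply lie_form_simps lie_form_commute[of v u] inner_simps)
       (simp add: field_simps)
qed

lemma op_inv_eqI:
  assumes "S o\<^sub>L T = id_blinfun" "T o\<^sub>L S = id_blinfun"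
  shows "op_inv T = S"
  unfolding op_inv_def
proof (rule the_equality)
  fix R :: R42_op
  assume R: "R o\<^sub>L T = id_blinfun \<and> T o\<^sub>L R = id_blinfun"
  show "R = S"
  proof (rule blinfun_eqI)
    fix w
    have "blinfun_apply R w = blinfun_apply R (blinfun_apply (T o\<^sub>L S) w)"
      using assms(2) by simp
    also have "\<dots> = blinfun_apply (R o\<^sub>L T) (blinfun_apply S w)"
      by simp
    also have "\<dots> = blinfun_apply S w"
      using R by (metis blinfun_apply_id_blinfun id_apply)
    finally show "blinfun_apply R w = blinfun_apply S w" .
  qed
qed (use assms in simp)

lemma op_inv_boost_map:
  assumes "lie_form u u = 0" "lie_form v v = 0" "lie_form u v \<noteq> 0" "s \<noteq> 0"
  shows "op_inv (boost_map u v s) = boost_map u v (inverse s)"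
  using boost_map_inverse[OF assms] boost_map_inverse[OF assms(1-3), of "inverse s"] assms(4)
  by (intro op_inv_eqI) simp_all

lemma op_exp_square_zero:
  assumes "T o\<^sub>L T = 0"
  shows "op_exp T = id_blinfun + T"
proof -
  have zero: "((o\<^sub>L) T ^^ n) id_blinfun = 0" if "n \<ge> 2" for n
    using that
  proof (induction n rule: nat_induct_at_least)
    case base
    have "T o\<^sub>L id_blinfun = T" by (rule blinfun_eqI) simp
    then show ?case using assms by (simp add: numeral_2_eq_2)
  next
    case (Suc n)
    then show ?case by simp
  qed
  have "op_exp T = (\<Sum>n<2. (1 / fact n) *\<^sub>R (((o\<^sub>L) T ^^ n) id_blinfun))"
    unfolding op_exp_def by (rule suminf_finite) (auto simp: zero not_less)
  then show ?thesis
    by (auto intro!: blinfun_eqI simp: numeral_2_eq_2)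
qed

lemma wedge_scaleR: "wedge (p *\<^sub>R u) (q *\<^sub>R v) = (p * q) *\<^sub>R wedge u v"
  by (simp add: wedge_eq_lie_tensor lie_tensor.scaleR_left lie_tensor.scaleR_right
      scaleR_diff_right mult.commute)

text \<open>The rescalings of the two generators cancel under the normalisation, so the wedge depends on the
lines only.  It is the derivative of the boost \<open>\<Gamma>\<^sub>a\<^sup>b(s)\<close> at \<open>s = 1\<close>.\<close>

definition nwedge :: "R42 set \<Rightarrow> R42 set \<Rightarrow> R42_op" where
  "nwedge a b = (THE T. \<exists>u\<in>a. \<exists>v\<in>b. lie_form u v = 1 \<and> T = wedge u v)"

lemma nwedge_span:
  assumes "lie_form u v \<noteq> 0"
  shows "nwedge (span {u}) (span {v}) = (1 / lie_form u v) *\<^sub>R wedge u v"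
  unfolding nwedge_def
proof (rule the_equality)
  show "\<exists>u'\<in>span {u}. \<exists>v'\<in>span {v}. lie_form u' v' = 1 \<and>
      (1 / lie_form u v) *\<^sub>R wedge u v = wedge u' v'"
    using assms
    by (intro bexI[of _ u] bexI[of _ "(1 / lie_form u v) *\<^sub>R v"])
       (auto simp: lie_form_simps wedge_scaleR[of 1 u, simplified] span_base span_mul)
next
  fix T
  assume "\<exists>u'\<in>span {u}. \<exists>v'\<in>span {v}. lie_form u' v' = 1 \<and> T = wedge u' v'"
  then obtain p q where "lie_form (p *\<^sub>R u) (q *\<^sub>R v) = 1" "T = wedge (p *\<^sub>R u) (q *\<^sub>R v)"
    by (auto simp: span_singleton)
  moreover from this have "p * q = 1 / lie_form u v"
    using assms by (simp add: lie_form_simps field_simps)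
  ultimately show "T = (1 / lie_form u v) *\<^sub>R wedge u v"
    by (simp add: wedge_scaleR)
qed

lemma wedge_space_span:
  "wedge_space (span {u}) (span {v}) = span {wedge u v}"
proof -
  have sub: "wedge_space (span {u}) (span {v}) \<subseteq> span {wedge u v}"
    unfolding wedge_space_def
  proof (rule span_minimal)
    show "{wedge u' v' |u' v'. u' \<in> span {u} \<and> v' \<in> span {v}} \<subseteq> span {wedge u v}"
    proof
      fix T assume "T \<in> {wedge u' v' |u' v'. u' \<in> span {u} \<and> v' \<in> span {v}}"
      then obtain p q where "T = wedge (p *\<^sub>R u) (q *\<^sub>R v)"
        by (auto simp: span_singleton)
      then have "T = (p * q) *\<^sub>R wedge u v"
        by (simp add: wedge_scaleR)
      then show "T \<in> span {wedge u v}"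
        by (simp add: span_base span_mul)
    qed
  qed simp
  have "wedge u v \<in> wedge_space (span {u}) (span {v})"
    unfolding wedge_space_def
    by (rule span_base, rule CollectI, rule exI[of _ u], rule exI[of _ v]) (simp add: span_base)
  then have "span {wedge u v} \<subseteq> wedge_space (span {u}) (span {v})"
    by (intro span_minimal) (simp_all add: wedge_space_def)
  with sub show ?thesis
    by (rule antisym)
qed

lemma blinfun_image_span_singleton:
  "blinfun_apply T ` span {u} = span {blinfun_apply T u}"
  by (simp add: span_singleton image_image blinfun.scaleR_right)

section \<open>Transport along one edge\<close>

text \<open>For null lines \<open>a\<close>, \<open>a'\<close>, having a nonzero \<open>\<tau>\<close> in \<open>a \<and> a'\<close> is a convenient way of saying that they are
distinct; together with orthogonality it makes their sum a contact element.\<close>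

definition isotropic_section :: "R42_op \<Rightarrow> R42 set \<Rightarrow> R42 set \<Rightarrow> bool" where
  "isotropic_section \<tau> a a' \<longleftrightarrow> a \<in> lie_quadric \<and> a' \<in> lie_quadric \<and> orthogonal_spaces a a' \<and>
     \<tau> \<in> wedge_space a a' \<and> \<tau> \<noteq> 0"

lemma isotropic_sectionE:
  assumes "isotropic_section \<tau> a a'"
  obtains u v c where "a = span {u}" "a' = span {v}" "\<tau> = c *\<^sub>R wedge u v" "c \<noteq> 0" "wedge u v \<noteq> 0"
    "u \<noteq> 0" "v \<noteq> 0" "lie_form u u = 0" "lie_form v v = 0" "lie_form u v = 0"
proof -
  obtain u where u: "u \<noteq> 0" "a = span {u}" "lie_form u u = 0"
    using assms lie_quadricE unfolding isotropic_section_def by blast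
  obtain v where v: "v \<noteq> 0" "a' = span {v}" "lie_form v v = 0"
    using assms lie_quadricE unfolding isotropic_section_def by blast
  obtain c where c: "\<tau> = c *\<^sub>R wedge u v"
    using assms unfolding isotropic_section_def u v wedge_space_span
    by (auto simp: span_singleton[of "wedge u v"])
  moreover have "lie_form u v = 0"
    using assms by (simp add: isotropic_section_def u v orthogonal_spaces_span_singleton)
  ultimately show ?thesis
    using that[OF u(2) v(2) c] u v assms by (auto simp: isotropic_section_def)
qed

lemma wedge_self [simp]: "wedge u u = 0"
  by (rule blinfun_eqI) (simp add: wedge_apply)

lemma wedge_add_right: "wedge u (v + w) = wedge u v + wedge u w"
  by (simp add: wedge_eq_lie_tensor lie_tensor.add_left lie_tensor.add_right)

lemma isotropic_section_imp_contact_element: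
  assumes "isotropic_section \<tau> a a'"
  shows "space_sum a a' \<in> contact_elements"
proof -
  obtain u v where uv: "a = span {u}" "a' = span {v}" "wedge u v \<noteq> 0"
    "u \<noteq> 0" "v \<noteq> 0" "lie_form u u = 0" "lie_form v v = 0" "lie_form u v = 0"
    using assms by (rule isotropic_sectionE)
  have sum: "space_sum a a' = span {u, v}"
    unfolding uv space_sum_def insert_is_Un[of u "{v}"] span_Un by auto
  have "u \<notin> span {v}"
  proof
    assume "u \<in> span {v}"
    then obtain c where "u = c *\<^sub>R v" by (auto simp: span_singleton)
    then have "wedge u v = 0"
      using wedge_scaleR[of c v 1 v] by simp
    with uv show False by simp
  qed
  then have "independent {u, v}" "u \<noteq> v"
    using uv by (auto simp: independent_insert span_base)
  then have "dim {u, v} = 2"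
    by (simp add: dim_eq_card_independent)
  moreover have "orthogonal_spaces (span {u, v}) (span {u, v})"
  proof -
    have "lie_form (p *\<^sub>R u + q *\<^sub>R v) (r *\<^sub>R u + s *\<^sub>R v) = 0" for p q r s
      using uv by (simp add: lie_form_simps lie_form_commute[of v u])
    then show ?thesis
      unfolding orthogonal_spaces_def sum[symmetric] uv space_sum_def span_singleton by blast
  qed
  ultimately show ?thesis
    by (simp add: null_subspaces_def sum)
qed

lemma op_exp_wedge_space:
  assumes "a \<in> lie_quadric" "a' \<in> lie_quadric" "orthogonal_spaces a a'" "\<tau> \<in> wedge_space a a'"
  shows "op_exp (t *\<^sub>R \<tau>) = id_blinfun + t *\<^sub>R \<tau>"
proof (rule op_exp_square_zero)
  obtain u where u: "a = span {u}" "lie_form u u = 0"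
    using assms(1) by (rule lie_quadricE)
  obtain v where v: "a' = span {v}" "lie_form v v = 0"
    using assms(2) by (rule lie_quadricE)
  have uv: "lie_form u v = 0"
    using assms(3) by (simp add: u v orthogonal_spaces_span_singleton)
  obtain c where "\<tau> = c *\<^sub>R wedge u v"
    using assms(4) unfolding u v wedge_space_span by (auto simp: span_singleton[of "wedge u v"])
  then show "t *\<^sub>R \<tau> o\<^sub>L t *\<^sub>R \<tau> = 0"
    using u(2) v(2) uv by (intro blinfun_eqI) (simp add: wedge_apply blinfun.scaleR_left blinfun.diff_left
        lie_form_simps lie_form_commute[of v u])
qed

lemma op_exp_isotropic_section:
  assumes "isotropic_section \<tau> a a'"
  shows "op_exp (t *\<^sub>R \<tau>) = id_blinfun + t *\<^sub>R \<tau>"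
  using assms by (intro op_exp_wedge_space[of a a']) (auto simp: isotropic_section_def)

text \<open>Generators that make the exponential and both boosts explicit.  Since \<open>exp (\<mu> \<tau>)\<close> moves \<open>w\<close> in the
direction \<open>v - u\<close>, for \<open>\<mu> \<noteq> 0\<close> this direction spans a line common to the two contact elements of the
edge.\<close>

lemma isotropic_edgeE:
  assumes "isotropic_section \<tau> a a'" "b \<in> lie_quadric" "\<not> orthogonal_spaces a b"
    "\<not> orthogonal_spaces a' b'" "b' = blinfun_apply (op_exp (\<mu> *\<^sub>R \<tau>)) ` b"
  obtains u v w c where "a = span {u}" "a' = span {v}" "b = span {w}" "c \<noteq> 0"
    "b' = span {w + (\<mu> * c) *\<^sub>R (v - u)}" "\<tau> = c *\<^sub>R wedge u v"
    "lie_form u u = 0" "lie_form v v = 0" "lie_form w w = 0"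
    "lie_form u v = 0" "lie_form u w = 1" "lie_form v w = 1" "v \<noteq> u"
proof -
  obtain u y d where u: "a = span {u}" "a' = span {y}" "\<tau> = d *\<^sub>R wedge u y" "d \<noteq> 0" "wedge u y \<noteq> 0"
    "lie_form u u = 0" "lie_form y y = 0" "lie_form u y = 0"
    using assms(1) by (rule isotropic_sectionE)
  have "span {u} \<in> lie_quadric"
    using assms(1) u by (simp add: isotropic_section_def)
  then obtain w where w: "b = span {w}" "lie_form u w = 1" "lie_form w w = 0"
    using assms(2,3) u nonorthogonal_linesE by metis
  have "b' = span {w + (\<mu> * d) *\<^sub>R (y - lie_form y w *\<^sub>R u)}"
    unfolding assms(5) w(1) blinfun_image_span_singleton op_exp_isotropic_section[OF assms(1)]
    by (simp add: u(3) w(2) wedge_apply blinfun.add_left blinfun.scaleR_left)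
  moreover from this have yw: "lie_form y w \<noteq> 0"
    using assms(4) u by (simp add: orthogonal_spaces_span_singleton lie_form_simps lie_form_commute[of y u])
  define v where "v = (1 / lie_form y w) *\<^sub>R y"
  have "a' = span {v}"
    using yw by (simp add: u v_def span_singleton_scaleR)
  moreover have "\<tau> = (d * lie_form y w) *\<^sub>R wedge u v"
    using wedge_scaleR[of 1 u "lie_form y w" v] yw by (simp add: u v_def)
  moreover have "b' = span {w + (\<mu> * (d * lie_form y w)) *\<^sub>R (v - u)}"
    using calculation(1) yw by (simp add: v_def scaleR_diff_right algebra_simps)
  moreover have "wedge u v \<noteq> 0"
    using wedge_scaleR[of 1 u "1 / lie_form y w" y] yw u by (simp add: v_def)
  then have "v \<noteq> u" by auto
  ultimately show ?thesis
    using that[of u v w "d * lie_form y w"] u w yw by (simp add: v_def lie_form_simps)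
qed

text \<open>In adapted generators \<open>\<tau>'\<close> is \<open>(1/\<mu>) w \<and> (v - u)\<close>, which is a multiple of \<open>w \<and> w'\<close>
because \<open>w' - w\<close> is a multiple of \<open>v - u\<close>.  The intertwining relation is then an identity of rational
functions in the coefficients with respect to \<open>u\<close>, \<open>v\<close>, \<open>w\<close>.\<close>

lemma isotropic_section_transfer:
  assumes \<tau>: "isotropic_section \<tau> a a'" and b: "b \<in> lie_quadric" and ab: "\<not> orthogonal_spaces a b"
    and ab': "\<not> orthogonal_spaces a' b'" and b': "b' = blinfun_apply (op_exp (\<mu> *\<^sub>R \<tau>)) ` b"
    and \<mu>: "\<mu> \<noteq> 0"
  defines "\<tau>' \<equiv> \<tau> + (1 / \<mu>) *\<^sub>R (nwedge a b - nwedge a' b')"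
  shows "isotropic_section \<tau>' b b'"
    and "t \<noteq> \<mu> \<Longrightarrow> boost a' b' (1 - t / \<mu>) =
      op_exp (t *\<^sub>R \<tau>') o\<^sub>L boost a b (1 - t / \<mu>) o\<^sub>L op_exp ((- t) *\<^sub>R \<tau>)"
proof -
  obtain u v w c where ab: "a = span {u}" "a' = span {v}" "b = span {w}" and c: "c \<noteq> 0"
    and b': "b' = span {w + (\<mu> * c) *\<^sub>R (v - u)}" and \<tau>_eq: "\<tau> = c *\<^sub>R wedge u v"
    and form: "lie_form u u = 0" "lie_form v v = 0" "lie_form w w = 0"
      "lie_form u v = 0" "lie_form u w = 1" "lie_form v w = 1" and "v \<noteq> u"
    using isotropic_edgeE[OF \<tau> b ab ab' b'] by metis
  define w' where "w' = w + (\<mu> * c) *\<^sub>R (v - u)"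
  have b': "b' = span {w'}" using b' by (simp add: w'_def)
  note form = form lie_form_commute[of v u] lie_form_commute[of w u] lie_form_commute[of w v]
  have form': "lie_form w' w' = 0" "lie_form u w' = 1" "lie_form v w' = 1"
    "lie_form w w' = 0" "lie_form w' w = 0"
    by (simp_all add: w'_def lie_form_simps form)
  have \<tau>': "\<tau>' = (1 / \<mu>) *\<^sub>R wedge w (v - u)"
  proof (rule blinfun_eqI)
    fix x
    show "blinfun_apply \<tau>' x = blinfun_apply ((1 / \<mu>) *\<^sub>R wedge w (v - u)) x"
      using form form' \<mu>
      by (simp add: \<tau>'_def \<tau>_eq ab b' nwedge_span blinfun.add_left blinfun.scaleR_left blinfun.diff_left
          wedge_apply)
         (simp add: w'_def lie_form_simps algebra_simps)
  qed
  have "\<tau>' = (1 / (\<mu>\<^sup>2 * c)) *\<^sub>R wedge w w'"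
    using \<mu> c by (simp add: \<tau>' w'_def wedge_add_right wedge_scaleR[of 1, simplified] power2_eq_square)
  then have "\<tau>' \<in> wedge_space b b'"
    by (simp add: ab b' wedge_space_span span_base span_mul)
  moreover have "\<tau>' \<noteq> 0"
  proof
    assume "\<tau>' = 0"
    then have "blinfun_apply \<tau>' u = 0" by simp
    then show False
      using \<mu> \<open>v \<noteq> u\<close> by (simp add: \<tau>' blinfun.scaleR_left wedge_apply lie_form_simps form)
  qed
  moreover have "w' \<noteq> 0"
    using form'(2) by (auto simp: lie_form_simps)
  ultimately show iso': "isotropic_section \<tau>' b b'"
    using b form form' span_singleton_lie_quadric[of w']
    by (simp add: isotropic_section_def ab b' orthogonal_spaces_span_singleton)
  assume t: "t \<noteq> \<mu>"
  show "boost a' b' (1 - t / \<mu>) =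
      op_exp (t *\<^sub>R \<tau>') o\<^sub>L boost a b (1 - t / \<mu>) o\<^sub>L op_exp ((- t) *\<^sub>R \<tau>)"
  proof (rule blinfun_eqI, rule vector_eqI_inner)
    fix x z
    have inv: "inverse (1 - t / \<mu>) - 1 = t / (\<mu> - t)"
      using \<mu> t by (simp add: field_simps)
    show "blinfun_apply (boost a' b' (1 - t / \<mu>)) x \<bullet> z =
      blinfun_apply (op_exp (t *\<^sub>R \<tau>') o\<^sub>L boost a b (1 - t / \<mu>) o\<^sub>L op_exp ((- t) *\<^sub>R \<tau>)) x \<bullet> z"
      unfolding op_exp_isotropic_section[OF iso'] op_exp_isotropic_section[OF \<tau>]
      using \<mu> t
      by (simp add: ab b' boost_span form form' boost_map_apply inv \<tau>' \<tau>_eq wedge_apply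
          blinfun.add_left blinfun.scaleR_left blinfun.minus_left blinfun.diff_left lie_form_simps,
          simp add: w'_def lie_form_simps inner_simps form,
          simp add: divide_simps,
          simp add: algebra_simps)
  qed
qed

text \<open>The boost changes \<open>p + t q\<close> by two terms.  The one along \<open>a\<close> is \<open>t / (\<mu> - t)\<close> times the pairing with
a generator of \<open>b\<close>, which vanishes at \<open>t = \<mu>\<close> by \<open>inc\<close>, so the pole cancels.  The one along \<open>b\<close> is
\<open>- t / \<mu>\<close> times the pairing with a generator of \<open>a\<close>, which is constant in \<open>t\<close> because \<open>q\<close> is
orthogonal to \<open>a\<close>, so the degree does not rise.\<close>

lemma conserved_quantity_transfer:
  assumes a: "a \<in> lie_quadric" and b: "b \<in> lie_quadric" and ab: "\<not> orthogonal_spaces a b"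
    and \<mu>: "\<mu> \<noteq> 0" and q: "orthogonal_spaces a {q}" and inc: "orthogonal_spaces {p + \<mu> *\<^sub>R q} b"
  defines "q' \<equiv> q - (1 / \<mu>) *\<^sub>R blinfun_apply (nwedge a b) p"
  shows "orthogonal_spaces b {q'}"
    and "lie_form (p + t *\<^sub>R q') (p + t *\<^sub>R q') = lie_form (p + t *\<^sub>R q) (p + t *\<^sub>R q)"
    and "t \<noteq> \<mu> \<Longrightarrow> blinfun_apply (boost a b (1 - t / \<mu>)) (p + t *\<^sub>R q) = p + t *\<^sub>R q'"
proof -
  obtain u where u: "a = span {u}" "lie_form u u = 0"
    using a by (rule lie_quadricE)
  obtain v where v: "b = span {v}" "lie_form u v = 1" "lie_form v v = 0"
    using a b ab u nonorthogonal_linesE by metis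
  have uq: "lie_form u q = 0"
    using q by (auto simp: u orthogonal_spaces_def span_base)
  have "lie_form (p + \<mu> *\<^sub>R q) v = 0"
    using inc by (auto simp: v orthogonal_spaces_def span_base)
  then have vp: "lie_form v p = - \<mu> * lie_form v q"
    by (simp add: lie_form_simps lie_form_commute[of _ v])
  note form = u(2) v(2,3) uq vp lie_form_commute[of v u] lie_form_commute[of p u] lie_form_commute[of p v]
     lie_form_commute[of q u] lie_form_commute[of q v]
  have q': "q' = q - (lie_form u p / \<mu>) *\<^sub>R v - lie_form v q *\<^sub>R u"
    using \<mu> by (simp add: q'_def u(1) v(1) nwedge_span form wedge_apply blinfun.scaleR_left
        algebra_simps)
  have "lie_form v q' = 0"
    by (simp add: q' lie_form_simps form)
  then show "orthogonal_spaces b {q'}"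
    by (auto simp: v(1) orthogonal_spaces_def span_singleton lie_form_simps)
  show "lie_form (p + t *\<^sub>R q') (p + t *\<^sub>R q') = lie_form (p + t *\<^sub>R q) (p + t *\<^sub>R q)"
    using \<mu> by (simp add: q' lie_form_simps form lie_form_commute[of q p]) (simp add: field_simps)
  show "blinfun_apply (boost a b (1 - t / \<mu>)) (p + t *\<^sub>R q) = p + t *\<^sub>R q'" if "t \<noteq> \<mu>"
  proof (rule vector_eqI_inner)
    fix z
    have inv: "inverse (1 - t / \<mu>) - 1 = t / (\<mu> - t)"
      using \<mu> that by (simp add: field_simps)
    show "blinfun_apply (boost a b (1 - t / \<mu>)) (p + t *\<^sub>R q) \<bullet> z = (p + t *\<^sub>R q') \<bullet> z"
      using \<mu> that
      by (simp add: u(1) v(1) boost_span form boost_map_apply inv q' lie_form_simps inner_simps)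
         (simp add: field_simps)
  qed
qed

section \<open>Bianchi quadrilaterals\<close>

text \<open>A boost is an orthogonal map, and an orthogonal map is injective because the form is
nondegenerate: pairing a vector with its reflection in the negative directions gives its Euclidean
norm.\<close>

lemma boost_image_lie_quadric:
  assumes a: "a \<in> lie_quadric" and b: "b \<in> lie_quadric" and ab: "\<not> orthogonal_spaces a b"
    and s: "s \<noteq> 0" and c: "c \<in> lie_quadric"
  shows "blinfun_apply (boost a b s) ` c \<in> lie_quadric"
proof -
  obtain u where u: "a = span {u}" "lie_form u u = 0"
    using a by (rule lie_quadricE)
  obtain v where v: "b = span {v}" "lie_form u v = 1" "lie_form v v = 0"
    using a b ab u nonorthogonal_linesE by metis
  obtain w where w: "c = span {w}" "lie_form w w = 0" "w \<noteq> 0"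
    using c by (rule lie_quadricE)
  have form: "lie_form u u = 0" "lie_form v v = 0" "lie_form u v \<noteq> 0"
    using u v by auto
  let ?w = "blinfun_apply (boost_map u v s) w"
  have "lie_form ?w ?w = 0"
    using lie_form_boost_map[OF form s] w by simp
  moreover have "?w \<noteq> 0"
  proof
    assume "?w = 0"
    then have "lie_form w x = 0" for x
      using lie_form_boost_map[OF form s, of w x] by (simp add: lie_form_simps)
    then have "lie_form w (fst w, - snd w) = 0" by simp
    then have "w \<bullet> w = 0"
      by (simp add: lie_form_def inner_prod_def)
    with w show False by simp
  qed
  ultimately show ?thesis
    unfolding u(1) v(1) w(1) boost_span[OF form] blinfun_image_span_singleton
    by (intro span_singleton_lie_quadric)
qed

lemma orthogonal_spaces_boost_image:
  assumes a: "a \<in> lie_quadric" and b: "b \<in> lie_quadric" and ab: "\<not> orthogonal_spaces a b"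
    and s: "s \<noteq> 0" and c: "orthogonal_spaces {x} c"
  shows "orthogonal_spaces {blinfun_apply (boost a b s) x} (blinfun_apply (boost a b s) ` c)"
proof -
  obtain u where u: "a = span {u}" "lie_form u u = 0"
    using a by (rule lie_quadricE)
  obtain v where v: "b = span {v}" "lie_form u v = 1" "lie_form v v = 0"
    using a b ab u nonorthogonal_linesE by metis
  have form: "lie_form u u = 0" "lie_form v v = 0" "lie_form u v \<noteq> 0"
    using u v by auto
  show ?thesis
    using c unfolding u(1) v(1) boost_span[OF form] orthogonal_spaces_def
    by (simp add: lie_form_boost_map[OF form s])
qed

locale bianchi_quad =
  fixes a b :: real and fi fj fl fk :: "R42 set"
  assumes params: "a \<noteq> 0" "b \<noteq> 0" "a \<noteq> b"
    and lines: "fi \<in> lie_quadric" "fj \<in> lie_quadric" "fl \<in> lie_quadric"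
    and nonorth: "\<not> orthogonal_spaces fi fj" "\<not> orthogonal_spaces fi fl" "\<not> orthogonal_spaces fj fk"
    and fk: "fk = bianchi a b fi fj fl"
begin

text \<open>With \<open>(u, v) = (u, w) = 1\<close> the only invariant left is \<open>c = (v, w)\<close>.  It cannot vanish, since
\<open>(v, k)\<close> is a multiple of it and \<open>fj\<close>, \<open>fk\<close> are not orthogonal.\<close>

lemma generators:
  obtains u v w k c where "fi = span {u}" "fj = span {v}" "fl = span {w}" "fk = span {k}"
    "lie_form u u = 0" "lie_form v v = 0" "lie_form w w = 0"
    "lie_form u v = 1" "lie_form u w = 1" "lie_form v w = c" "c \<noteq> 0"
    "k = w - (b / a) *\<^sub>R v + (c * b / (a - b)) *\<^sub>R u"
proof -
  obtain u where u: "fi = span {u}" "lie_form u u = 0"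
    using lines(1) by (rule lie_quadricE)
  obtain v where v: "fj = span {v}" "lie_form u v = 1" "lie_form v v = 0"
    using lines nonorth u nonorthogonal_linesE by metis
  obtain w where w: "fl = span {w}" "lie_form u w = 1" "lie_form w w = 0"
    using lines nonorth u nonorthogonal_linesE by metis
  define c where "c = lie_form v w"
  define k where "k = w - (b / a) *\<^sub>R v + (c * b / (a - b)) *\<^sub>R u"
  have "inverse (1 - b / a) - 1 = b / (a - b)"
    using params by (simp add: field_simps)
  then have "blinfun_apply (boost_map u v (1 - b / a)) w = k"
    using u v w by (simp add: boost_map_apply k_def c_def mult.commute)
  then have fk_eq: "fk = span {k}"
    using u v
    by (simp add: fk bianchi_def boost_span w(1) blinfun_image_span_singleton)
  have "lie_form v k = c * a / (a - b)"
    using params u v w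
    by (simp add: k_def lie_form_simps lie_form_commute[of v u] c_def[symmetric] field_simps)
  then have "c \<noteq> 0"
    using nonorth(3) by (auto simp: v fk_eq orthogonal_spaces_span_singleton)
  then show ?thesis
    using that[OF u(1) v(1) w(1) fk_eq u(2) v(3) w(3) v(2) w(2) c_def[symmetric] _ k_def] by simp
qed

lemma fk_in_lie_quadric: "fk \<in> lie_quadric"
  unfolding fk bianchi_def
  by (rule boost_image_lie_quadric) (use lines nonorth params in auto)

lemma fk_symmetric: "fk = bianchi b a fi fl fj"
proof -
  obtain u v w k c where g: "fi = span {u}" "fj = span {v}" "fl = span {w}" "fk = span {k}"
    "lie_form u u = 0" "lie_form v v = 0" "lie_form w w = 0"
    "lie_form u v = 1" "lie_form u w = 1" "lie_form v w = c"
    "k = w - (b / a) *\<^sub>R v + (c * b / (a - b)) *\<^sub>R u"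
    by (rule generators)
  define k' where "k' = v - (a / b) *\<^sub>R w + (c * a / (b - a)) *\<^sub>R u"
  have "inverse (1 - a / b) - 1 = a / (b - a)"
    using params by (simp add: field_simps)
  then have "blinfun_apply (boost_map u w (1 - a / b)) v = k'"
    using g by (simp add: boost_map_apply k'_def lie_form_commute[of w v] mult.commute)
  then have "bianchi b a fi fl fj = span {k'}"
    using g by (simp add: bianchi_def boost_span g(2) blinfun_image_span_singleton)
  moreover have "k' = (- a / b) *\<^sub>R k"
  proof (rule vector_eqI_inner)
    show "k' \<bullet> z = ((- a / b) *\<^sub>R k) \<bullet> z" for z
      using params by (simp add: k'_def g inner_simps field_simps)
  qed
  ultimately show ?thesis
    using params span_singleton_scaleR[of "- a / b" k] g(4) by simp
qed

text \<open>All four boosts preserve the span of \<open>u\<close>, \<open>v\<close>, \<open>w\<close> and fix its orthogonal complement, so this is an identity of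
rational functions in \<open>a\<close>, \<open>b\<close>, \<open>c\<close> and \<open>t\<close>.\<close>

lemma flatness:
  assumes "t \<noteq> a" "t \<noteq> b"
  shows "boost fj fk (1 - t / b) o\<^sub>L boost fi fj (1 - t / a) =
    boost fl fk (1 - t / a) o\<^sub>L boost fi fl (1 - t / b)"
proof -
  obtain u v w k c where g: "fi = span {u}" "fj = span {v}" "fl = span {w}" "fk = span {k}"
    "lie_form u u = 0" "lie_form v v = 0" "lie_form w w = 0"
    "lie_form u v = 1" "lie_form u w = 1" "lie_form v w = c" "c \<noteq> 0"
    and k: "k = w - (b / a) *\<^sub>R v + (c * b / (a - b)) *\<^sub>R u"
    by (rule generators)
  note form = g(5-10) lie_form_commute[of v u] lie_form_commute[of w u] lie_form_commute[of w v]
  have kk: "lie_form k k = 0" "lie_form v k = c * a / (a - b)" "lie_form w k = c * b\<^sup>2 / (a * (a - b))"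
    using params
    by (simp_all add: k lie_form_simps form)
       (simp_all add: divide_simps power2_eq_square, simp_all add: algebra_simps)
  have inv: "inverse (1 - t / a) - 1 = t / (a - t)" "inverse (1 - t / b) - 1 = t / (b - t)"
    using params assms by (simp_all add: field_simps)
  show ?thesis
  proof (rule blinfun_eqI, rule vector_eqI_inner)
    fix x z
    show "blinfun_apply (boost fj fk (1 - t / b) o\<^sub>L boost fi fj (1 - t / a)) x \<bullet> z =
      blinfun_apply (boost fl fk (1 - t / a) o\<^sub>L boost fi fl (1 - t / b)) x \<bullet> z"
      using params g(11) assms
      by (simp add: g(1-4) boost_span form kk boost_map_apply inv lie_form_simps,
          simp add: k lie_form_simps inner_simps form power2_eq_square,
          simp add: divide_simps,
          simp add: algebra_simps)
  qed
qed

text \<open>Since the boost \<open>\<Gamma>\<^sub>a\<^sup>b(1 - t / m)\<close> is \<open>1 - t N / m\<close> up to terms of order \<open>t\<^sup>2\<close>, this is the first order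
part of the flatness of the discrete connection.\<close>

lemma nwedge_closed:
  "(1 / a) *\<^sub>R nwedge fi fj + (1 / b) *\<^sub>R nwedge fj fk = (1 / b) *\<^sub>R nwedge fi fl + (1 / a) *\<^sub>R nwedge fl fk"
proof -
  obtain u v w k c where g: "fi = span {u}" "fj = span {v}" "fl = span {w}" "fk = span {k}"
    "lie_form u u = 0" "lie_form v v = 0" "lie_form w w = 0"
    "lie_form u v = 1" "lie_form u w = 1" "lie_form v w = c" "c \<noteq> 0"
    and k: "k = w - (b / a) *\<^sub>R v + (c * b / (a - b)) *\<^sub>R u"
    by (rule generators)
  note form = g(5-10) lie_form_commute[of v u] lie_form_commute[of w u] lie_form_commute[of w v]
  have kk: "lie_form v k = c * a / (a - b)" "lie_form w k = c * b\<^sup>2 / (a * (a - b))"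
    using params
    by (simp_all add: k lie_form_simps form)
       (simp_all add: divide_simps power2_eq_square, simp_all add: algebra_simps)
  show ?thesis
  proof (rule blinfun_eqI, rule vector_eqI_inner)
    fix x z
    show "blinfun_apply ((1 / a) *\<^sub>R nwedge fi fj + (1 / b) *\<^sub>R nwedge fj fk) x \<bullet> z =
      blinfun_apply ((1 / b) *\<^sub>R nwedge fi fl + (1 / a) *\<^sub>R nwedge fl fk) x \<bullet> z"
      using params g(11)
      by (simp add: g(1-4) nwedge_span form kk blinfun.add_left blinfun.scaleR_left wedge_apply,
          simp add: k lie_form_simps inner_simps form power2_eq_square,
          simp add: divide_simps,
          simp add: algebra_simps)
  qed
qed

end

lemma op_exp_cancel:
  assumes "isotropic_section \<tau> a a'"
  shows "blinfun_apply (op_exp ((- t) *\<^sub>R \<tau>)) (blinfun_apply (op_exp (t *\<^sub>R \<tau>)) x) = x"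
proof -
  obtain u v c where uv: "\<tau> = c *\<^sub>R wedge u v"
    "lie_form u u = 0" "lie_form v v = 0" "lie_form u v = 0"
    using assms by (rule isotropic_sectionE)
  then have "blinfun_apply \<tau> (blinfun_apply \<tau> x) = 0"
    by (simp add: wedge_apply blinfun.scaleR_left lie_form_simps lie_form_commute[of v u])
  then show ?thesis
    by (simp only: op_exp_isotropic_section[OF assms])
       (simp add: blinfun.add_left blinfun.diff_left blinfun.scaleR_left blinfun.add_right blinfun.scaleR_right)
qed

text \<open>The boost across the edge \<open>(i, j)\<close> at the value \<open>t = b\<close> constructs the fourth point, and the
intertwining relation at the same value says how it exchanges the two families.  Thus the incidence on the
edge \<open>(i, l)\<close> passes to the opposite edge \<open>(j, k)\<close>.\<close>

lemma bianchi_transfer: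
  assumes \<tau>: "isotropic_section \<tau> fi fi'"
    and inter: "boost fi' fj' (1 - b / a) =
      op_exp (b *\<^sub>R \<tau>') o\<^sub>L boost fi fj (1 - b / a) o\<^sub>L op_exp ((- b) *\<^sub>R \<tau>)"
    and l: "fl' = blinfun_apply (op_exp (b *\<^sub>R \<tau>)) ` fl"
  shows "bianchi a b fi' fj' fl' = blinfun_apply (op_exp (b *\<^sub>R \<tau>')) ` bianchi a b fi fj fl"
  by (simp only: bianchi_def inter l image_image blinfun_apply_blinfun_compose op_exp_cancel[OF \<tau>])

section \<open>Bianchi lattices and their potentials\<close>

text \<open>A property that is transported along edges on which an incidence holds, while the incidences are
transported across quadrilaterals, spreads from the axes over the lattice.\<close>

lemma lattice_induct:
  fixes valid inc\<^sub>h inc\<^sub>v :: "nat \<Rightarrow> nat \<Rightarrow> bool"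
  assumes "valid 0 0" and "\<And>m. inc\<^sub>h m 0" and "\<And>n. inc\<^sub>v 0 n"
    and step\<^sub>h: "\<And>m n. valid m n \<Longrightarrow> inc\<^sub>h m n \<Longrightarrow> valid (Suc m) n"
    and step\<^sub>v: "\<And>m n. valid m n \<Longrightarrow> inc\<^sub>v m n \<Longrightarrow> valid m (Suc n)"
    and quad\<^sub>v: "\<And>m n. valid m n \<Longrightarrow> inc\<^sub>h m n \<Longrightarrow> inc\<^sub>v m n \<Longrightarrow> inc\<^sub>v (Suc m) n"
    and quad\<^sub>h: "\<And>m n. valid m n \<Longrightarrow> inc\<^sub>h m n \<Longrightarrow> inc\<^sub>v m n \<Longrightarrow> inc\<^sub>h m (Suc n)"
  shows "valid m n \<and> inc\<^sub>h m n \<and> inc\<^sub>v m n"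
proof (induction n arbitrary: m)
  case 0
  show ?case
    by (induction m) (use assms in blast)+
next
  case (Suc n)
  show ?case
    by (induction m) (use Suc assms in blast)+
qed

locale bianchi_net =
  fixes \<alpha> \<beta> :: "nat \<Rightarrow> real" and f :: "nat \<Rightarrow> nat \<Rightarrow> R42 set"
  assumes params: "\<And>m. \<alpha> m \<noteq> 0" "\<And>n. \<beta> n \<noteq> 0" "\<And>m n. \<alpha> m \<noteq> \<beta> n"
    and axes: "\<And>m. f m 0 \<in> lie_quadric" "\<And>n. f 0 n \<in> lie_quadric"
    and nonorth: "\<And>m n. \<not> orthogonal_spaces (f m n) (f (Suc m) n)"
      "\<And>m n. \<not> orthogonal_spaces (f m n) (f m (Suc n))"
    and bianchi: "\<And>m n. f (Suc m) (Suc n) = bianchi (\<alpha> m) (\<beta> n) (f m n) (f (Suc m) n) (f m (Suc n))"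
begin

lemma lines: "f m n \<in> lie_quadric"
proof (induction n arbitrary: m)
  case 0
  show ?case by (rule axes)
next
  case (Suc n)
  show ?case
  proof (induction m)
    case 0
    show ?case by (rule axes)
  next
    case (Suc m)
    interpret bianchi_quad "\<alpha> m" "\<beta> n" "f m n" "f (Suc m) n" "f m (Suc n)" "f (Suc m) (Suc n)"
      by unfold_locales (rule params nonorth bianchi Suc \<open>\<And>m. f m n \<in> lie_quadric\<close>)+
    show ?case by (rule fk_in_lie_quadric)
  qed
qed

lemma quad: "bianchi_quad (\<alpha> m) (\<beta> n) (f m n) (f (Suc m) n) (f m (Suc n)) (f (Suc m) (Suc n))"
  by unfold_locales (rule params nonorth bianchi lines)+

lemma quad_symmetric:
  "f (Suc m) (Suc n) = bianchi (\<beta> n) (\<alpha> m) (f m n) (f m (Suc n)) (f (Suc m) n)"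
  using quad by (rule bianchi_quad.fk_symmetric)

lemma discrete_isothermic: "discrete_isothermic (\<lambda>m n. \<alpha> m) (\<lambda>m n. \<beta> n) f"
  using params lines nonorth bianchi_quad.flatness[OF quad]
  by (auto simp: discrete_isothermic_def edge_labelling_def conn_h_def conn_v_def)

text \<open>The sum of the one-form \<open>N / m\<close> along the path that follows the first axis and then turns.\<close>

definition potential :: "nat \<Rightarrow> nat \<Rightarrow> R42_op" where
  "potential m n = (\<Sum>i<m. (1 / \<alpha> i) *\<^sub>R nwedge (f i 0) (f (Suc i) 0))
     + (\<Sum>j<n. (1 / \<beta> j) *\<^sub>R nwedge (f m j) (f m (Suc j)))"

lemma potential_0 [simp]: "potential 0 0 = 0"
  by (simp add: potential_def)

lemma potential_v: "potential m (Suc n) = potential m n + (1 / \<beta> n) *\<^sub>R nwedge (f m n) (f m (Suc n))"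
  by (simp add: potential_def)

text \<open>Closedness on each quadrilateral makes the sum path-independent.\<close>

lemma potential_h: "potential (Suc m) n = potential m n + (1 / \<alpha> m) *\<^sub>R nwedge (f m n) (f (Suc m) n)"
proof (induction n)
  case 0
  show ?case by (simp add: potential_def)
next
  case (Suc n)
  have "potential (Suc m) (Suc n) = potential m n + ((1 / \<alpha> m) *\<^sub>R nwedge (f m n) (f (Suc m) n)
      + (1 / \<beta> n) *\<^sub>R nwedge (f (Suc m) n) (f (Suc m) (Suc n)))"
    by (simp add: potential_v Suc)
  also have "\<dots> = potential m (Suc n) + (1 / \<alpha> m) *\<^sub>R nwedge (f m (Suc n)) (f (Suc m) (Suc n))"
    unfolding bianchi_quad.nwedge_closed[OF quad] by (simp add: potential_v)
  finally show ?case .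
qed

text \<open>The constant coefficient is the same vector at all lattice points; only the linear one varies, with the
potential.\<close>

lemma guichard_quantity:
  fixes p q :: R42
  defines "Q \<equiv> \<lambda>m n. q - blinfun_apply (potential m n) p"
  assumes start: "orthogonal_spaces (f 0 0) {q}"
    and inc: "\<And>m. orthogonal_spaces {p + \<alpha> m *\<^sub>R Q m 0} (f (Suc m) 0)"
      "\<And>n. orthogonal_spaces {p + \<beta> n *\<^sub>R Q 0 n} (f 0 (Suc n))"
    and norm: "\<And>t. lie_form (p + t *\<^sub>R q) (p + t *\<^sub>R q) = r + s * t" "r \<noteq> 0" "s \<noteq> 0"
  shows "guichard_quantity_for (\<lambda>m n. \<alpha> m) (\<lambda>m n. \<beta> n) f"
proof -
  let ?valid = "\<lambda>m n. orthogonal_spaces (f m n) {Q m n} \<and>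
      (\<forall>t. lie_form (p + t *\<^sub>R Q m n) (p + t *\<^sub>R Q m n) = r + s * t)"
  let ?inc\<^sub>h = "\<lambda>m n. orthogonal_spaces {p + \<alpha> m *\<^sub>R Q m n} (f (Suc m) n)"
  let ?inc\<^sub>v = "\<lambda>m n. orthogonal_spaces {p + \<beta> n *\<^sub>R Q m n} (f m (Suc n))"
  have Q_h: "Q (Suc m) n = Q m n - (1 / \<alpha> m) *\<^sub>R blinfun_apply (nwedge (f m n) (f (Suc m) n)) p" for m n
    by (simp add: Q_def potential_h blinfun.add_left blinfun.scaleR_left)
  have Q_v: "Q m (Suc n) = Q m n - (1 / \<beta> n) *\<^sub>R blinfun_apply (nwedge (f m n) (f m (Suc n))) p" for m n
    by (simp add: Q_def potential_v blinfun.add_left blinfun.scaleR_left)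
  have transfer_h: "?valid (Suc m) n"
    "\<And>t. t \<noteq> \<alpha> m \<Longrightarrow> blinfun_apply (boost (f m n) (f (Suc m) n) (1 - t / \<alpha> m)) (p + t *\<^sub>R Q m n)
       = p + t *\<^sub>R Q (Suc m) n"
    if "?valid m n" "?inc\<^sub>h m n" for m n
    using conserved_quantity_transfer[OF lines lines nonorth(1) params(1) _ that(2)] that(1)
    by (simp_all add: Q_h)
  have transfer_v: "?valid m (Suc n)"
    "\<And>t. t \<noteq> \<beta> n \<Longrightarrow> blinfun_apply (boost (f m n) (f m (Suc n)) (1 - t / \<beta> n)) (p + t *\<^sub>R Q m n)
       = p + t *\<^sub>R Q m (Suc n)"
    if "?valid m n" "?inc\<^sub>v m n" for m n
    using conserved_quantity_transfer[OF lines lines nonorth(2) params(2) _ that(2)] that(1)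
    by (simp_all add: Q_v)
  have quad_v: "?inc\<^sub>v (Suc m) n" if "?valid m n" "?inc\<^sub>h m n" "?inc\<^sub>v m n" for m n
  proof -
    have "p + \<beta> n *\<^sub>R Q (Suc m) n =
        blinfun_apply (boost (f m n) (f (Suc m) n) (1 - \<beta> n / \<alpha> m)) (p + \<beta> n *\<^sub>R Q m n)"
      using transfer_h(2)[OF that(1,2), of "\<beta> n"] params(3)[of m n] by simp
    then show ?thesis
      using orthogonal_spaces_boost_image[where s = "1 - \<beta> n / \<alpha> m",
          OF lines[of m n] lines[of "Suc m" n] nonorth(1) _ that(3)]
        params
      by (simp add: bianchi bianchi_def)
  qed
  have quad_h: "?inc\<^sub>h m (Suc n)" if "?valid m n" "?inc\<^sub>h m n" "?inc\<^sub>v m n" for m n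
  proof -
    have "p + \<alpha> m *\<^sub>R Q m (Suc n) =
        blinfun_apply (boost (f m n) (f m (Suc n)) (1 - \<alpha> m / \<beta> n)) (p + \<alpha> m *\<^sub>R Q m n)"
      using transfer_v(2)[OF that(1,3), of "\<alpha> m"] params(3)[of m n] by simp
    then show ?thesis
      using orthogonal_spaces_boost_image[where s = "1 - \<alpha> m / \<beta> n",
          OF lines[of m n] lines[of m "Suc n"] nonorth(2) _ that(2)]
        params params(3)[symmetric]
      by (simp add: quad_symmetric bianchi_def)
  qed
  have "?valid 0 0"
    using start norm by (simp add: Q_def)
  then have all: "?valid m n \<and> ?inc\<^sub>h m n \<and> ?inc\<^sub>v m n" for m n
    by (rule lattice_induct[of ?valid ?inc\<^sub>h ?inc\<^sub>v])
       (fact inc transfer_h(1) transfer_v(1) quad_v quad_h)+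
  have "discrete_linear_conserved_quantity (\<lambda>m n. \<alpha> m) (\<lambda>m n. \<beta> n) f (\<lambda>m n. p) Q"
    unfolding discrete_linear_conserved_quantity_def conn_h_def conn_v_def
    using all transfer_h(2) transfer_v(2) by blast
  then show ?thesis
    unfolding guichard_quantity_for_def using all norm(2,3) by blast
qed

end

section \<open>Lattices of isotropic pairs\<close>

locale isotropic_nets = plus: bianchi_net \<alpha> \<beta> fp + minus: bianchi_net \<alpha> \<beta> fm
  for \<alpha> \<beta> fp fm +
  fixes \<tau>\<^sub>0 :: R42_op and T
  defines "T \<equiv> \<lambda>m n. \<tau>\<^sub>0 + plus.potential m n - minus.potential m n"
  assumes start: "isotropic_section \<tau>\<^sub>0 (fp 0 0) (fm 0 0)"
    and inc: "\<And>m. fm (Suc m) 0 = blinfun_apply (op_exp (\<alpha> m *\<^sub>R T m 0)) ` fp (Suc m) 0"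
      "\<And>n. fm 0 (Suc n) = blinfun_apply (op_exp (\<beta> n *\<^sub>R T 0 n)) ` fp 0 (Suc n)"
begin

lemma T_h: "T (Suc m) n = T m n +
    (1 / \<alpha> m) *\<^sub>R (nwedge (fp m n) (fp (Suc m) n) - nwedge (fm m n) (fm (Suc m) n))"
  by (simp add: T_def plus.potential_h minus.potential_h algebra_simps)

lemma T_v: "T m (Suc n) = T m n +
    (1 / \<beta> n) *\<^sub>R (nwedge (fp m n) (fp m (Suc n)) - nwedge (fm m n) (fm m (Suc n)))"
  by (simp add: T_def plus.potential_v minus.potential_v algebra_simps)

lemma transfer_h:
  assumes "isotropic_section (T m n) (fp m n) (fm m n)"
    and "fm (Suc m) n = blinfun_apply (op_exp (\<alpha> m *\<^sub>R T m n)) ` fp (Suc m) n"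
  shows "isotropic_section (T (Suc m) n) (fp (Suc m) n) (fm (Suc m) n)"
    and "t \<noteq> \<alpha> m \<Longrightarrow> boost (fm m n) (fm (Suc m) n) (1 - t / \<alpha> m) = op_exp (t *\<^sub>R T (Suc m) n)
      o\<^sub>L boost (fp m n) (fp (Suc m) n) (1 - t / \<alpha> m) o\<^sub>L op_exp ((- t) *\<^sub>R T m n)"
  unfolding T_h
  using isotropic_section_transfer[OF assms(1) plus.lines plus.nonorth(1) minus.nonorth(1) assms(2)
    plus.params(1)] by blast+

lemma transfer_v:
  assumes "isotropic_section (T m n) (fp m n) (fm m n)"
    and "fm m (Suc n) = blinfun_apply (op_exp (\<beta> n *\<^sub>R T m n)) ` fp m (Suc n)"
  shows "isotropic_section (T m (Suc n)) (fp m (Suc n)) (fm m (Suc n))"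
    and "t \<noteq> \<beta> n \<Longrightarrow> boost (fm m n) (fm m (Suc n)) (1 - t / \<beta> n) = op_exp (t *\<^sub>R T m (Suc n))
      o\<^sub>L boost (fp m n) (fp m (Suc n)) (1 - t / \<beta> n) o\<^sub>L op_exp ((- t) *\<^sub>R T m n)"
  unfolding T_v
  using isotropic_section_transfer[OF assms(1) plus.lines plus.nonorth(2) minus.nonorth(2) assms(2)
    plus.params(2)] by blast+

lemma isotropic:
  "isotropic_section (T m n) (fp m n) (fm m n) \<and>
   fm (Suc m) n = blinfun_apply (op_exp (\<alpha> m *\<^sub>R T m n)) ` fp (Suc m) n \<and>
   fm m (Suc n) = blinfun_apply (op_exp (\<beta> n *\<^sub>R T m n)) ` fp m (Suc n)"
proof (rule lattice_induct[where valid = "\<lambda>m n. isotropic_section (T m n) (fp m n) (fm m n)"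
      and inc\<^sub>h = "\<lambda>m n. fm (Suc m) n = blinfun_apply (op_exp (\<alpha> m *\<^sub>R T m n)) ` fp (Suc m) n"
      and inc\<^sub>v = "\<lambda>m n. fm m (Suc n) = blinfun_apply (op_exp (\<beta> n *\<^sub>R T m n)) ` fp m (Suc n)"])
  show "isotropic_section (T 0 0) (fp 0 0) (fm 0 0)"
    using start by (simp add: T_def)
next
  fix m n
  assume *: "isotropic_section (T m n) (fp m n) (fm m n)"
    "fm (Suc m) n = blinfun_apply (op_exp (\<alpha> m *\<^sub>R T m n)) ` fp (Suc m) n"
    "fm m (Suc n) = blinfun_apply (op_exp (\<beta> n *\<^sub>R T m n)) ` fp m (Suc n)"
  show "fm (Suc m) (Suc n) = blinfun_apply (op_exp (\<beta> n *\<^sub>R T (Suc m) n)) ` fp (Suc m) (Suc n)"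
    unfolding plus.bianchi minus.bianchi
    by (rule bianchi_transfer[OF *(1) transfer_h(2)[OF *(1,2)] *(3)]) (metis plus.params(3))
  show "fm (Suc m) (Suc n) = blinfun_apply (op_exp (\<alpha> m *\<^sub>R T m (Suc n))) ` fp (Suc m) (Suc n)"
    unfolding plus.quad_symmetric minus.quad_symmetric
    by (rule bianchi_transfer[OF *(1) transfer_v(2)[OF *(1,3)] *(2)]) (metis plus.params(3))
qed (use inc transfer_h(1) transfer_v(1) in auto)

lemma discrete_omega_surface:
  "discrete_omega_surface_via (\<lambda>m n. \<alpha> m) (\<lambda>m n. \<beta> n) fp fm (\<lambda>m n. space_sum (fp m n) (fm m n))"
proof -
  have "T m n \<in> wedge_space (fp m n) (fm m n)" for m n
    using isotropic by (simp add: isotropic_section_def)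
  moreover have "space_sum (fp m n) (fm m n) \<in> contact_elements" for m n
    using isotropic isotropic_section_imp_contact_element by blast
  ultimately show ?thesis
    unfolding discrete_omega_surface_via_def discrete_isotropic_pair_def conn_h_def conn_v_def
    using plus.discrete_isothermic minus.discrete_isothermic
      transfer_h(2) transfer_v(2) isotropic
    by blast
qed

end

section \<open>Differentiation in charts\<close>

lemma chart_at:
  assumes "smooth_atlas A"
  obtains c where "c \<in> A" "x \<in> fst c"
  using assms unfolding smooth_atlas_def by (metis UNIV_I UN_iff)

lemma chart_inv_chart:
  assumes "smooth_atlas A" "c \<in> A" "x \<in> fst c"
  shows "chart_inv c (snd c x) = x"
  using assms by (auto simp: smooth_atlas_def homeomorphism_def)

lemma open_chart_image:
  assumes "smooth_atlas A" "c \<in> A" "open W"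
  shows "open (snd c ` (fst c \<inter> W))"
proof -
  have c: "open (fst c)" "open (snd c ` fst c)"
    "homeomorphism (fst c) (snd c ` fst c) (snd c) (chart_inv c)"
    using assms by (auto simp: smooth_atlas_def)
  have "openin (top_of_set (snd c ` fst c)) (snd c ` (fst c \<inter> W))"
    by (rule homeomorphism_imp_open_map[OF c(3)]) (use assms in \<open>simp add: openin_open_Int\<close>)
  then show ?thesis
    using c(2) openin_open_trans by blast
qed

lemma chart_inv_mem:
  assumes "smooth_atlas A" "c \<in> A" "z \<in> snd c ` (fst c \<inter> W)"
  shows "chart_inv c z \<in> W"
  using assms chart_inv_chart by fastforce

lemma smooth_map_differentiable:
  assumes "smooth_map A W g" "c \<in> A" "x \<in> fst c" "x \<in> W"
  shows "(g \<circ> chart_inv c) differentiable (at (snd c x))"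
proof -
  have "Ck_on (Suc 0) (snd c ` (fst c \<inter> W)) (g \<circ> chart_inv c)"
    using assms by (simp add: smooth_map_def smooth_on_def del: Ck_on.simps)
  then show ?thesis
    using assms by auto
qed

lemma smooth_map_const:
  fixes v :: "'v::real_normed_vector"
  shows "smooth_map A W (\<lambda>_. v)"
proof -
  have "Ck_on k S (\<lambda>_. w)" for k and w :: 'v and S :: "(real ^ 2) set"
    by (induction k arbitrary: w) (auto simp: frechet_derivative_const)
  then show ?thesis
    by (simp add: smooth_map_def smooth_on_def o_def)
qed

text \<open>A family of gauge relations \<open>d + t\<eta>' = g \<circ> (d + t\<eta>) \<circ> h\<close>, tested on constant vector fields and
divided by \<open>t\<close>, determines \<open>\<eta>' - \<eta>\<close> as the limit of \<open>dh / t\<close>.\<close>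

lemma gauge_first_order:
  fixes g h :: "real \<Rightarrow> 'p::{t2_space, second_countable_topology} \<Rightarrow> R42_op"
  assumes A: "smooth_atlas A" "c \<in> A" "x \<in> fst c"
    and gauge: "\<forall>\<^sub>F t in at 0. conn_gauge A (g t) (h t) \<eta> \<eta>' t"
    and D: "\<forall>\<^sub>F t in at 0. ((h t \<circ> chart_inv c) has_derivative D t) (at (snd c x))"
    and g: "((\<lambda>t. g t x) \<longlongrightarrow> id_blinfun) (at 0)"
    and h: "((\<lambda>t. h t x) \<longlongrightarrow> id_blinfun) (at 0)"
    and L: "((\<lambda>t. (1 / t) *\<^sub>R D t X) \<longlongrightarrow> L) (at 0)"
  shows "blinfun_apply (\<eta>' c x) X = blinfun_apply (\<eta> c x) X + L"
proof (rule blinfun_eqI)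
  fix e
  let ?R = "\<lambda>t. blinfun_apply (g t x) (blinfun_apply ((1 / t) *\<^sub>R D t X) e
      + blinfun_apply (blinfun_apply (\<eta> c x) X) (blinfun_apply (h t x) e))"
  have "\<forall>\<^sub>F t in at 0. t \<noteq> (0 :: real)"
    by (simp add: eventually_at_filter)
  then have "\<forall>\<^sub>F t in at 0. blinfun_apply (blinfun_apply (\<eta>' c x) X) e = ?R t"
    using gauge D
  proof eventually_elim
    case (elim t)
    have "((\<lambda>z. blinfun_apply (h t (chart_inv c z)) e) has_derivative (\<lambda>X. blinfun_apply (D t X) e))
        (at (snd c x))"
      using bounded_linear.has_derivative[OF blinfun.bounded_linear_left elim(3), of e]
      by (simp add: o_def)
    then have "chart_deriv c (\<lambda>y. blinfun_apply (h t y) e) x X = blinfun_apply (D t X) e"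
      unfolding chart_deriv_def o_def by (simp add: frechet_derivative_at[symmetric])
    moreover have "chart_deriv c (\<lambda>_. e) x X = 0"
      by (simp add: chart_deriv_def o_def frechet_derivative_const)
    moreover have "conn \<eta>' t (\<lambda>_. e) c x X =
        blinfun_apply (g t x) (conn \<eta> t (\<lambda>y. blinfun_apply (h t y) e) c x X)"
      using elim(2) smooth_map_const[of A UNIV e] A(2,3) unfolding conn_gauge_def by blast
    ultimately have "t *\<^sub>R blinfun_apply (blinfun_apply (\<eta>' c x) X) e =
        blinfun_apply (g t x) (blinfun_apply (D t X) e
          + t *\<^sub>R blinfun_apply (blinfun_apply (\<eta> c x) X) (blinfun_apply (h t x) e))"
      by (simp add: conn_def)
    then have "(1 / t) *\<^sub>R t *\<^sub>R blinfun_apply (blinfun_apply (\<eta>' c x) X) e =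
        (1 / t) *\<^sub>R blinfun_apply (g t x) (blinfun_apply (D t X) e
          + t *\<^sub>R blinfun_apply (blinfun_apply (\<eta> c x) X) (blinfun_apply (h t x) e))"
      by simp
    then show ?case
      using elim(1)
      by (simp add: blinfun.scaleR_left blinfun.scaleR_right blinfun.add_right scaleR_add_right)
  qed
  then have "(?R \<longlongrightarrow> blinfun_apply (blinfun_apply (\<eta>' c x) X) e) (at 0)"
    by (rule tendsto_eventually[OF eventually_mono]) simp
  moreover have "(?R \<longlongrightarrow> blinfun_apply id_blinfun (blinfun_apply L e
      + blinfun_apply (blinfun_apply (\<eta> c x) X) (blinfun_apply id_blinfun e))) (at 0)"
    by (intro tendsto_intros blinfun.tendsto g h L)
  ultimately show "blinfun_apply (blinfun_apply (\<eta>' c x) X) e =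
      blinfun_apply (blinfun_apply (\<eta> c x) X + L) e"
    using tendsto_unique[OF trivial_limit_at] by (fastforce simp: blinfun.add_left add.commute)
qed

lemma sphere_congruence_local_generator:
  assumes "sphere_congruence A f"
  obtains W \<sigma> where "open W" "x \<in> W" "smooth_map A W \<sigma>" "\<And>y. y \<in> W \<Longrightarrow> f y = span {\<sigma> y}"
proof -
  obtain W \<sigma> where W: "open W" "x \<in> W" "\<forall>i<1. smooth_map A W (\<sigma> i)"
    "\<forall>y\<in>W. dim (f y) = 1 \<and> f y = span ((\<lambda>i. \<sigma> i y) ` {..<1 :: nat})"
    using assms unfolding sphere_congruence_def smooth_subbundle_def by metis
  then show ?thesis
    using that[of W "\<sigma> 0"] by (auto simp: lessThan_Suc)
qed

text \<open>The inverse boost is \<open>1 + (t / (\<mu> - t)) V - (t / \<mu>) V'\<close>, where \<open>V\<close> and \<open>V'\<close> are the projections onto \<open>f'\<close>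
and \<open>f\<close>; the limit of its derivative divided by \<open>t\<close> is \<open>d(V - V') / \<mu>\<close>, and \<open>V - V'\<close> is the normalised
wedge.\<close>

lemma darboux_form:
  assumes A: "smooth_atlas A" "c \<in> A" "x \<in> fst c"
    and f: "sphere_congruence A f" and dt: "darboux_transform A \<mu> f \<eta> f' \<eta>'"
  obtains D where "((\<lambda>z. nwedge (f (chart_inv c z)) (f' (chart_inv c z))) has_derivative D) (at (snd c x))"
    "\<And>X. blinfun_apply (\<eta>' c x) X = blinfun_apply (\<eta> c x) X + (1 / \<mu>) *\<^sub>R D X"
proof -
  have f': "sphere_congruence A f'" and \<mu>: "\<mu> \<noteq> 0"
    and nonorth: "\<And>y. \<not> orthogonal_spaces (f y) (f' y)"
    using dt by (auto simp: darboux_transform_def)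
  obtain W \<sigma> where W: "open W" "x \<in> W" "smooth_map A W \<sigma>" "\<And>y. y \<in> W \<Longrightarrow> f y = span {\<sigma> y}"
    using sphere_congruence_local_generator[OF f, of x] by blast
  obtain W' \<sigma>' where W': "open W'" "x \<in> W'" "smooth_map A W' \<sigma>'" "\<And>y. y \<in> W' \<Longrightarrow> f' y = span {\<sigma>' y}"
    using sphere_congruence_local_generator[OF f', of x] by blast
  let ?y = "snd c x" and ?S = "snd c ` (fst c \<inter> (W \<inter> W'))"
  have S: "open ?S" "?y \<in> ?S"
    using A W(1,2) W'(1,2) by (auto intro!: open_chart_image)
  have x: "chart_inv c ?y = x"
    using A by (rule chart_inv_chart)
  define u where "u = (\<lambda>z. \<sigma> (chart_inv c z))"
  define v where "v = (\<lambda>z. \<sigma>' (chart_inv c z))"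
  have uv: "f (chart_inv c z) = span {u z}" "f' (chart_inv c z) = span {v z}"
    "lie_form (u z) (u z) = 0" "lie_form (v z) (v z) = 0" "lie_form (u z) (v z) \<noteq> 0"
    if "z \<in> ?S" for z
  proof -
    have z: "chart_inv c z \<in> W \<inter> W'"
      using A(1,2) that by (rule chart_inv_mem)
    then show *: "f (chart_inv c z) = span {u z}" "f' (chart_inv c z) = span {v z}"
      using W(4) W'(4) by (auto simp: u_def v_def)
    have "f (chart_inv c z) \<in> lie_quadric" "f' (chart_inv c z) \<in> lie_quadric"
      using f f' by (auto simp: sphere_congruence_def)
    then show "lie_form (u z) (u z) = 0" "lie_form (v z) (v z) = 0"
      unfolding * by (simp_all add: null_subspaces_def orthogonal_spaces_span_singleton)
    show "lie_form (u z) (v z) \<noteq> 0"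
      using nonorth[of "chart_inv c z"] unfolding * by (simp add: orthogonal_spaces_span_singleton)
  qed
  define V where "V = (\<lambda>z. inverse (lie_form (u z) (v z)) *\<^sub>R lie_tensor (u z) (v z))"
  define V' where "V' = (\<lambda>z. inverse (lie_form (u z) (v z)) *\<^sub>R lie_tensor (v z) (u z))"
  obtain Du Dv where "(u has_derivative Du) (at ?y)" "(v has_derivative Dv) (at ?y)"
    using smooth_map_differentiable[OF W(3) A(2,3) W(2)] smooth_map_differentiable[OF W'(3) A(2,3) W'(2)]
    unfolding u_def v_def o_def differentiable_def by blast
  note d = this lie_form.FDERIV[OF this] lie_tensor.FDERIV[OF this] lie_tensor.FDERIV[OF this(2,1)]
  obtain DV DV' where DV: "(V has_derivative DV) (at ?y)" "(V' has_derivative DV') (at ?y)"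
    unfolding V_def V'_def
    using has_derivative_scaleR[OF Deriv.has_derivative_inverse[OF uv(5)[OF S(2)] d(3)] d(4)]
      has_derivative_scaleR[OF Deriv.has_derivative_inverse[OF uv(5)[OF S(2)] d(3)] d(5)] by blast
  have nw: "nwedge (f (chart_inv c z)) (f' (chart_inv c z)) = V z - V' z" if "z \<in> ?S" for z
    using uv[OF that]
    by (simp add: nwedge_span V_def V'_def wedge_eq_lie_tensor scaleR_diff_right inverse_eq_divide)
  have Dn: "((\<lambda>z. nwedge (f (chart_inv c z)) (f' (chart_inv c z))) has_derivative (\<lambda>X. DV X - DV' X)) (at ?y)"
    by (rule has_derivative_transform_within_open[OF has_derivative_diff[OF DV] S]) (simp add: nw)
  let ?g = "\<lambda>t y. boost (f y) (f' y) (1 - t / \<mu>)"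
  let ?h = "\<lambda>t y. op_inv (boost (f y) (f' y) (1 - t / \<mu>))"
  have g: "?g t (chart_inv c z) = id_blinfun - (t / \<mu>) *\<^sub>R V z + (t / (\<mu> - t)) *\<^sub>R V' z"
    and h: "?h t (chart_inv c z) = id_blinfun + (t / (\<mu> - t)) *\<^sub>R V z - (t / \<mu>) *\<^sub>R V' z"
    if "t \<noteq> \<mu>" "z \<in> ?S" for t z
  proof -
    have inv: "inverse (1 - t / \<mu>) - 1 = t / (\<mu> - t)" "1 - t / \<mu> \<noteq> 0"
      using \<mu> that by (simp_all add: field_simps)
    show "?g t (chart_inv c z) = id_blinfun - (t / \<mu>) *\<^sub>R V z + (t / (\<mu> - t)) *\<^sub>R V' z"
      using uv[OF that(2)] by (simp add: boost_span boost_map_def inv inv(1)[unfolded divide_inverse] V_def V'_def divide_inverse)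
    show "?h t (chart_inv c z) = id_blinfun + (t / (\<mu> - t)) *\<^sub>R V z - (t / \<mu>) *\<^sub>R V' z"
      using uv[OF that(2)] inv(2)
      by (simp add: boost_span op_inv_boost_map) (simp add: boost_map_def inv inv(1)[unfolded divide_inverse] V_def V'_def divide_inverse)
  qed
  have ev: "\<forall>\<^sub>F t in at 0. t \<noteq> 0 \<and> t \<noteq> \<mu>"
    using \<mu> by (auto simp: eventually_at intro!: exI[of _ "\<bar>\<mu>\<bar>"])
  have form: "blinfun_apply (\<eta>' c x) X = blinfun_apply (\<eta> c x) X + (1 / \<mu>) *\<^sub>R (DV X - DV' X)" for X
  proof (rule gauge_first_order[OF A])
    show "\<forall>\<^sub>F t in at 0. conn_gauge A (?g t) (?h t) \<eta> \<eta>' t"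
      using ev by eventually_elim (use dt in \<open>simp add: darboux_transform_def\<close>)
    show "\<forall>\<^sub>F t in at 0. ((?h t \<circ> chart_inv c) has_derivative
        (\<lambda>X. (t / (\<mu> - t)) *\<^sub>R DV X - (t / \<mu>) *\<^sub>R DV' X)) (at ?y)"
      using ev
    proof eventually_elim
      case (elim t)
      have "((\<lambda>z. id_blinfun + (t / (\<mu> - t)) *\<^sub>R V z - (t / \<mu>) *\<^sub>R V' z) has_derivative
        (\<lambda>X. 0 + (t / (\<mu> - t)) *\<^sub>R DV X - (t / \<mu>) *\<^sub>R DV' X)) (at ?y)"
        by (intro derivative_intros DV)
      then have "((?h t \<circ> chart_inv c) has_derivative
        (\<lambda>X. 0 + (t / (\<mu> - t)) *\<^sub>R DV X - (t / \<mu>) *\<^sub>R DV' X)) (at ?y)"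
        by (rule has_derivative_transform_within_open[OF _ S]) (use elim h in simp)
      then show ?case by simp
    qed
    have lim: "((\<lambda>t. t / (\<mu> - t)) \<longlongrightarrow> 0 / (\<mu> - 0)) (at 0)" "((\<lambda>t. t / \<mu>) \<longlongrightarrow> 0 / \<mu>) (at 0)"
      using \<mu> by (intro tendsto_intros; simp)+
    have "((\<lambda>t. id_blinfun - (t / \<mu>) *\<^sub>R V ?y + (t / (\<mu> - t)) *\<^sub>R V' ?y) \<longlongrightarrow>
        id_blinfun - (0 / \<mu>) *\<^sub>R V ?y + (0 / (\<mu> - 0)) *\<^sub>R V' ?y) (at 0)"
      by (intro tendsto_intros lim)
    from Lim_transform_eventually[OF this]
    show "((\<lambda>t. ?g t x) \<longlongrightarrow> id_blinfun) (at 0)"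
      using eventually_mono[OF ev] g[OF _ S(2)] x by simp
    have "((\<lambda>t. id_blinfun + (t / (\<mu> - t)) *\<^sub>R V ?y - (t / \<mu>) *\<^sub>R V' ?y) \<longlongrightarrow>
        id_blinfun + (0 / (\<mu> - 0)) *\<^sub>R V ?y - (0 / \<mu>) *\<^sub>R V' ?y) (at 0)"
      by (intro tendsto_intros lim)
    from Lim_transform_eventually[OF this]
    show "((\<lambda>t. ?h t x) \<longlongrightarrow> id_blinfun) (at 0)"
      using eventually_mono[OF ev] h[OF _ S(2)] x by simp
    have "((\<lambda>t. (1 / (\<mu> - t)) *\<^sub>R DV X - (1 / \<mu>) *\<^sub>R DV' X) \<longlongrightarrow>
        (1 / (\<mu> - 0)) *\<^sub>R DV X - (1 / \<mu>) *\<^sub>R DV' X) (at 0)"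
      using \<mu> by (intro tendsto_intros) auto
    then have "((\<lambda>t. (1 / (\<mu> - t)) *\<^sub>R DV X - (1 / \<mu>) *\<^sub>R DV' X) \<longlongrightarrow>
        (1 / \<mu>) *\<^sub>R (DV X - DV' X)) (at 0)"
      by (simp add: scaleR_diff_right)
    from Lim_transform_eventually[OF this]
    show "((\<lambda>t. (1 / t) *\<^sub>R ((t / (\<mu> - t)) *\<^sub>R DV X - (t / \<mu>) *\<^sub>R DV' X)) \<longlongrightarrow>
        (1 / \<mu>) *\<^sub>R (DV X - DV' X)) (at 0)"
      using eventually_mono[OF ev] by (simp add: scaleR_diff_right)
  qed
  show ?thesis
    by (rule that[OF Dn form])
qed

section \<open>Isotropic pairs and the uniqueness of their gauge\<close>

lemma contact_imp_orthogonal: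
  assumes "space_sum a b \<in> contact_elements" "a \<in> lie_quadric" "b \<in> lie_quadric"
  shows "orthogonal_spaces a b"
proof -
  have "0 \<in> a" "0 \<in> b"
    using assms by (auto simp: null_subspaces_def subspace_0)
  have "u \<in> space_sum a b" if "u \<in> a" for u
    unfolding space_sum_def using that \<open>0 \<in> b\<close> by (metis (mono_tags, lifting) CollectI add.right_neutral)
  moreover have "v \<in> space_sum a b" if "v \<in> b" for v
    unfolding space_sum_def using that \<open>0 \<in> a\<close> by (metis (mono_tags, lifting) CollectI add.left_neutral)
  ultimately show ?thesis
    using assms(1) by (auto simp: null_subspaces_def orthogonal_spaces_def)
qed

text \<open>Here the gauge is \<open>1 - t \<tau>\<close>, because \<open>\<tau>\<close> squares to zero.\<close>

lemma isotropic_pair_form: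
  assumes A: "smooth_atlas A" "c \<in> A" "x \<in> fst c"
    and pair: "isotropic_pair_via A \<tau> fp \<eta>p fm \<eta>m"
    and orth: "\<And>y. orthogonal_spaces (fp y) (fm y)"
  obtains D where "((\<tau> \<circ> chart_inv c) has_derivative D) (at (snd c x))"
    "\<And>X. blinfun_apply (\<eta>m c x) X = blinfun_apply (\<eta>p c x) X - D X"
proof -
  have exp: "op_exp (t *\<^sub>R \<tau> y) = id_blinfun + t *\<^sub>R \<tau> y" for t y
    using pair orth
    by (intro op_exp_wedge_space[of "fp y" "fm y"])
       (auto simp: isotropic_pair_via_def isothermic_def sphere_congruence_def)
  obtain D where D: "((\<tau> \<circ> chart_inv c) has_derivative D) (at (snd c x))"
    using smooth_map_differentiable[of A UNIV \<tau> c x] pair A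
    by (auto simp: isotropic_pair_via_def differentiable_def)
  have "blinfun_apply (\<eta>m c x) X = blinfun_apply (\<eta>p c x) X + - D X" for X
  proof (rule gauge_first_order[OF A])
    show "\<forall>\<^sub>F t in at 0. conn_gauge A (\<lambda>y. op_exp (t *\<^sub>R \<tau> y)) (\<lambda>y. op_exp ((- t) *\<^sub>R \<tau> y)) \<eta>p \<eta>m t"
      using pair by (simp add: isotropic_pair_via_def)
    show "\<forall>\<^sub>F t in at 0. ((\<lambda>y. op_exp ((- t) *\<^sub>R \<tau> y)) \<circ> chart_inv c has_derivative
        (\<lambda>X. 0 + (- t) *\<^sub>R D X)) (at (snd c x))"
      using D unfolding exp o_def by (intro always_eventually allI derivative_intros)
    have "((\<lambda>t. id_blinfun + t *\<^sub>R \<tau> x) \<longlongrightarrow> id_blinfun + 0 *\<^sub>R \<tau> x) (at 0)"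
      "((\<lambda>t. id_blinfun + (- t) *\<^sub>R \<tau> x) \<longlongrightarrow> id_blinfun + (- 0) *\<^sub>R \<tau> x) (at 0)"
      by (intro tendsto_intros)+
    then show "((\<lambda>t. op_exp (t *\<^sub>R \<tau> x)) \<longlongrightarrow> id_blinfun) (at 0)"
      "((\<lambda>t. op_exp ((- t) *\<^sub>R \<tau> x)) \<longlongrightarrow> id_blinfun) (at 0)"
      unfolding exp by simp_all
    show "((\<lambda>t. (1 / t) *\<^sub>R (0 + (- t) *\<^sub>R D X)) \<longlongrightarrow> - D X) (at 0)"
      by (rule tendsto_eventually) (simp add: eventually_at_filter)
  qed
  then show ?thesis
    using that[OF D] by simp
qed

text \<open>The range is all of the plane because the form is nondegenerate: preimages of \<open>u\<close> and \<open>v\<close> are combinations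
of the reflected vectors \<open>J u\<close>, \<open>J v\<close>, whose pairings with \<open>u\<close>, \<open>v\<close> form the Euclidean Gram matrix.  Its
determinant \<open>d\<close> vanishes only for dependent vectors.\<close>

lemma space_sum_eq_range_wedge:
  assumes "wedge u v \<noteq> 0" "c \<noteq> 0"
  shows "space_sum (span {u}) (span {v}) = range (blinfun_apply (c *\<^sub>R wedge u v))"
proof -
  define J :: "R42 \<Rightarrow> R42" where "J = (\<lambda>w. (fst w, - snd w))"
  have J: "lie_form w (J z) = w \<bullet> z" for w z
    by (simp add: lie_form_def J_def inner_prod_def)
  define d where "d = (v \<bullet> v) * (u \<bullet> u) - (u \<bullet> v)\<^sup>2"
  have d: "d \<noteq> 0"
  proof
    assume "d = 0"
    have "u \<bullet> u \<noteq> 0"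
      using assms(1) by (auto simp: wedge_eq_lie_tensor lie_tensor.zero_left lie_tensor.zero_right)
    have "((u \<bullet> u) *\<^sub>R v - (u \<bullet> v) *\<^sub>R u) \<bullet> ((u \<bullet> u) *\<^sub>R v - (u \<bullet> v) *\<^sub>R u) = (u \<bullet> u) * d"
      by (simp add: d_def inner_simps inner_commute[of v u] power2_eq_square algebra_simps)
    then have "(u \<bullet> u) *\<^sub>R v = (u \<bullet> v) *\<^sub>R u"
      using \<open>d = 0\<close> by simp
    then have "v = ((u \<bullet> v) / (u \<bullet> u)) *\<^sub>R u"
      using \<open>u \<bullet> u \<noteq> 0\<close> by (metis (no_types, lifting) divide_inverse_commute scaleR_left_imp_eq
          scaleR_scaleR scaleR_one left_inverse)
    then show False
      using assms(1) wedge_scaleR[of 1 u "(u \<bullet> v) / (u \<bullet> u)" u] by simp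
  qed
  have "p *\<^sub>R u + q *\<^sub>R v = blinfun_apply (c *\<^sub>R wedge u v)
      ((1 / (c * d)) *\<^sub>R (p *\<^sub>R ((u \<bullet> v) *\<^sub>R J u - (u \<bullet> u) *\<^sub>R J v) + q *\<^sub>R ((v \<bullet> v) *\<^sub>R J u - (u \<bullet> v) *\<^sub>R J v)))"
    (is "_ = ?r") for p q
  proof (rule vector_eqI_inner)
    fix z
    have "(c * d) * ((p *\<^sub>R u + q *\<^sub>R v) \<bullet> z) = (c * d) * (?r \<bullet> z)"
      using d assms(2)
      by (simp add: blinfun.scaleR_left blinfun.scaleR_right blinfun.add_right blinfun.diff_right
          wedge_apply J inner_simps inner_commute[of v u])
         (simp add: d_def algebra_simps power2_eq_square)
    then show "(p *\<^sub>R u + q *\<^sub>R v) \<bullet> z = ?r \<bullet> z"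
      using d assms(2) by simp
  qed
  then have "space_sum (span {u}) (span {v}) \<subseteq> range (blinfun_apply (c *\<^sub>R wedge u v))"
    unfolding space_sum_def span_singleton by blast
  moreover have "blinfun_apply (c *\<^sub>R wedge u v) w \<in> space_sum (span {u}) (span {v})" for w
    unfolding space_sum_def
    by (rule CollectI, rule exI[of _ "(- c * lie_form v w) *\<^sub>R u"], rule exI[of _ "(c * lie_form u w) *\<^sub>R v"])
       (simp add: blinfun.scaleR_left wedge_apply span_mul span_base span_neg scaleR_diff_right)
  ultimately show ?thesis by blast
qed

text \<open>Derivatives of sections of a constant bundle stay in the fibre, so every tangent vector violates the
immersion condition.\<close>

lemma legendre_immersion_not_constant:
  fixes A :: "('p::{t2_space, second_countable_topology}) chart set"
  assumes A: "smooth_atlas A" and L: "legendre_immersion A (\<lambda>_. L)"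
  shows False
proof -
  fix x :: 'p
  obtain c where c: "c \<in> A" "x \<in> fst c"
    using chart_at[OF A] by blast
  have sub: "subspace L"
    using L by (simp add: legendre_immersion_def null_subspaces_def)
  have "chart_deriv c u x X \<in> L" if u: "x \<in> W" "local_section A W (\<lambda>_. L) u" for W u X
  proof -
    have W: "open W" "smooth_map A W u" "\<And>y. y \<in> W \<Longrightarrow> u y \<in> L"
      using u by (auto simp: local_section_def)
    obtain D where D: "((u \<circ> chart_inv c) has_derivative D) (at (snd c x))"
      using smooth_map_differentiable[OF W(2) c u(1)] by (auto simp: differentiable_def)
    \<comment> \<open>Pairing with a fixed vector orthogonal to \<open>L\<close> turns \<open>u\<close> into the zero function near \<open>x\<close>.\<close>
    have "D X \<in> L\<^sup>\<bottom>\<^sup>\<bottom>"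
      unfolding orthogonal_comp_def
    proof (intro CollectI ballI)
      fix z assume z: "z \<in> {z. \<forall>l\<in>L. orthogonal l z}"
      have "((\<lambda>y. (u \<circ> chart_inv c) y \<bullet> z) has_derivative (\<lambda>X. D X \<bullet> z)) (at (snd c x))"
        using D by (intro derivative_intros)
      moreover have "((\<lambda>y. (u \<circ> chart_inv c) y \<bullet> z) has_derivative (\<lambda>X. 0)) (at (snd c x))"
      proof (rule has_derivative_transform_within_open[OF has_derivative_const])
        show "open (snd c ` (fst c \<inter> W))" "snd c x \<in> snd c ` (fst c \<inter> W)"
          using A c W(1) u(1) by (auto intro: open_chart_image)
        show "0 = (u \<circ> chart_inv c) y \<bullet> z" if "y \<in> snd c ` (fst c \<inter> W)" for y
          using z W(3)[OF chart_inv_mem[OF A c(1) that]] by (simp add: orthogonal_def)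
      qed
      ultimately have "(\<lambda>X. D X \<bullet> z) = (\<lambda>X. 0)"
        by (rule has_derivative_unique)
      then show "orthogonal z (D X)"
        by (metis inner_commute orthogonal_def)
    qed
    then have "D X \<in> L"
      using orthogonal_comp_self[OF sub] by simp
    then show ?thesis
      using D by (simp add: chart_deriv_def frechet_derivative_at[symmetric])
  qed
  then have "axis 1 1 = (0 :: real ^ 2)"
    using L c unfolding legendre_immersion_def by blast
  then show False
    by (simp add: axis_eq_0_iff)
qed

text \<open>A homotopy between two constant loops sweeps out a connected set that contains both base points.\<close>

lemma simply_connected_space_imp_connected:
  assumes "simply_connected (UNIV :: 'p::topological_space set)"
  shows "connected (UNIV :: 'p set)"
proof (rule connectedI)
  fix U V :: "'p set"
  assume UV: "open U" "open V" "U \<inter> UNIV \<noteq> {}" "V \<inter> UNIV \<noteq> {}" "U \<inter> V \<inter> UNIV = {}" "UNIV \<subseteq> U \<union> V"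
  then obtain a b where ab: "a \<in> U" "b \<in> V" by blast
  let ?p = "\<lambda>y. \<lambda>t :: real. y"
  have "homotopic_loops UNIV (?p a) (?p b)"
    using assms unfolding simply_connected_def
    by (simp add: path_def pathstart_def pathfinish_def)
  then obtain h where h: "continuous_on ({0..1::real} \<times> {0..1::real}) h"
    "\<forall>t\<in>{0..1}. h (0, t) = a" "\<forall>t\<in>{0..1}. h (1, t) = b"
    unfolding homotopic_loops by auto
  have "connected (h ` ({0..1} \<times> {0..1}))"
    using h(1) by (intro connected_continuous_image connected_Times connected_Icc)
  moreover have "a \<in> h ` ({0..1} \<times> {0..1})" "b \<in> h ` ({0..1} \<times> {0..1})"
    using h(2,3) by (force intro: rev_image_eqI[of "(0, 0)"], force intro: rev_image_eqI[of "(1, 0)"])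
  ultimately show False
    using UV ab unfolding connected_def by blast
qed

lemma zero_chart_derivative_imp_constant:
  fixes \<sigma> :: "'p::{t2_space, second_countable_topology} \<Rightarrow> 'v::real_normed_vector"
  assumes A: "smooth_atlas A" and conn: "connected (UNIV :: 'p set)"
    and D: "\<And>c x. c \<in> A \<Longrightarrow> x \<in> fst c \<Longrightarrow> ((\<sigma> \<circ> chart_inv c) has_derivative (\<lambda>X. 0)) (at (snd c x))"
  shows "\<sigma> x = \<sigma> y"
proof -
  have loc: "\<exists>T. open T \<and> x \<in> T \<and> (\<forall>y\<in>T. \<sigma> y = \<sigma> x)" for x
  proof -
    obtain c where c: "c \<in> A" "x \<in> fst c"
      using chart_at[OF A] by blast
    have C: "open (fst c)" "open (snd c ` fst c)" "continuous_on (fst c) (snd c)"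
      using A c by (auto simp: smooth_atlas_def homeomorphism_def)
    obtain r where r: "r > 0" "ball (snd c x) r \<subseteq> snd c ` fst c"
      using C(2) c by (meson imageI openE)
    have "((\<sigma> \<circ> chart_inv c) has_derivative (\<lambda>X. 0)) (at z within ball (snd c x) r)"
      if z: "z \<in> ball (snd c x) r" for z
    proof -
      obtain w where "w \<in> fst c" "z = snd c w"
        using z r(2) by blast
      then show ?thesis
        using has_derivative_at_withinI[OF D[OF c(1)]] by simp
    qed
    from has_derivative_zero_constant[OF convex_ball this]
    obtain k where k: "\<And>z. z \<in> ball (snd c x) r \<Longrightarrow> (\<sigma> \<circ> chart_inv c) z = k"
      by meson
    have "\<sigma> y = k" if "y \<in> fst c \<inter> snd c -` ball (snd c x) r" for y
      using k[of "snd c y"] that chart_inv_chart[OF A c(1)] by auto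
    moreover have "x \<in> fst c \<inter> snd c -` ball (snd c x) r"
      using c r by simp
    moreover have "open (fst c \<inter> snd c -` ball (snd c x) r)"
      using C by (intro continuous_open_preimage) auto
    ultimately show ?thesis by metis
  qed
  have "\<sigma> constant_on UNIV"
    using loc by (intro locally_constant_imp_constant[OF conn]) (auto simp: openin_subtopology)
  then show ?thesis
    by (auto simp: constant_on_def)
qed

text \<open>This is applied to differences of two gauges.  A constant nonzero section would recover the contact
element at each point as its range.\<close>

lemma isotropic_gauge_unique:
  fixes \<sigma> :: "'p::{t2_space, second_countable_topology} \<Rightarrow> R42_op"
  assumes A: "smooth_atlas A" and conn: "connected (UNIV :: 'p set)"
    and L: "legendre_immersion A (\<lambda>x. space_sum (fp x) (fm x))"
    and lines: "\<And>x. fp x \<in> lie_quadric" "\<And>x. fm x \<in> lie_quadric"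
    and mem: "\<And>x. \<sigma> x \<in> wedge_space (fp x) (fm x)"
    and D: "\<And>c x. c \<in> A \<Longrightarrow> x \<in> fst c \<Longrightarrow> ((\<sigma> \<circ> chart_inv c) has_derivative (\<lambda>X. 0)) (at (snd c x))"
  shows "\<sigma> x = 0"
proof (rule ccontr)
  assume nz: "\<sigma> x \<noteq> 0"
  have const: "\<sigma> y = \<sigma> x" for y
    by (rule zero_chart_derivative_imp_constant[OF A conn D])
  have "space_sum (fp y) (fm y) = range (blinfun_apply (\<sigma> x))" for y
  proof -
    have "orthogonal_spaces (fp y) (fm y)"
      using L lines by (intro contact_imp_orthogonal) (auto simp: legendre_immersion_def)
    then have "isotropic_section (\<sigma> x) (fp y) (fm y)"
      using lines nz mem[of y] const[of y] by (simp add: isotropic_section_def)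
    then obtain u v c where "fp y = span {u}" "fm y = span {v}" "\<sigma> x = c *\<^sub>R wedge u v" "c \<noteq> 0"
      "wedge u v \<noteq> 0"
      by (rule isotropic_sectionE)
    then show ?thesis
      using space_sum_eq_range_wedge by simp
  qed
  then show False
    using legendre_immersion_not_constant[OF A] L by simp
qed

section \<open>Eisenhart transforms along the axes\<close>

lemma omega_surfaceD:
  assumes "omega_surface A S"
  shows "isothermic A (sph_p S) (form_p S)" "isothermic A (sph_m S) (form_m S)"
    "sphere_congruence A (sph_p S)" "sphere_congruence A (sph_m S)"
    "sph_p S x \<in> lie_quadric" "sph_m S x \<in> lie_quadric"
    "space_sum (sph_p S x) (sph_m S x) \<in> contact_elements"
    "orthogonal_spaces (sph_p S x) (sph_m S x)"
    "legendre_immersion A (\<lambda>x. space_sum (sph_p S x) (sph_m S x))"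
proof -
  show *: "isothermic A (sph_p S) (form_p S)" "isothermic A (sph_m S) (form_m S)"
    "sphere_congruence A (sph_p S)" "sphere_congruence A (sph_m S)"
    "legendre_immersion A (\<lambda>x. space_sum (sph_p S x) (sph_m S x))"
    using assms by (auto simp: omega_surface_def isotropic_pair_via_def isothermic_def)
  then show **: "sph_p S x \<in> lie_quadric" "sph_m S x \<in> lie_quadric"
    "space_sum (sph_p S x) (sph_m S x) \<in> contact_elements"
    by (auto simp: sphere_congruence_def legendre_immersion_def)
  show "orthogonal_spaces (sph_p S x) (sph_m S x)"
    by (rule contact_imp_orthogonal[OF **(3,1,2)])
qed

abbreviation isotropic_gauge where
  "isotropic_gauge A \<tau> S \<equiv> isotropic_pair_via A \<tau> (sph_p S) (form_p S) (sph_m S) (form_m S)"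

text \<open>The two axes meet in the initial surface, where their first transforms may have been built with different
gauges.\<close>

lemma isotropic_gauge_determined:
  fixes A :: "('p::{t2_space, second_countable_topology}) chart set"
  assumes A: "smooth_atlas A" and conn: "connected (UNIV :: 'p set)"
    and S: "omega_surface A S"
    and \<tau>: "isotropic_gauge A \<tau> S" and \<tau>': "isotropic_gauge A \<tau>' S"
  shows "\<tau>' x = \<tau> x"
proof -
  note om = omega_surfaceD[OF S]
  define \<sigma> where "\<sigma> = (\<lambda>y. \<tau>' y - \<tau> y)"
  have "\<sigma> x = 0"
  proof (rule isotropic_gauge_unique[OF A conn om(9,5,6)])
    show "\<sigma> y \<in> wedge_space (sph_p S y) (sph_m S y)" for y
      using \<tau> \<tau>' unfolding \<sigma>_def isotropic_pair_via_def wedge_space_def by (blast intro: span_diff)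
  next
    fix c y
    assume c: "c \<in> A" "y \<in> fst c"
    obtain D where D: "((\<tau> \<circ> chart_inv c) has_derivative D) (at (snd c y))"
      "\<And>X. blinfun_apply (form_m S c y) X = blinfun_apply (form_p S c y) X - D X"
      using isotropic_pair_form[OF A c \<tau> om(8)] by blast
    obtain D' where D': "((\<tau>' \<circ> chart_inv c) has_derivative D') (at (snd c y))"
      "\<And>X. blinfun_apply (form_m S c y) X = blinfun_apply (form_p S c y) X - D' X"
      using isotropic_pair_form[OF A c \<tau>' om(8)] by blast
    have "((\<sigma> \<circ> chart_inv c) has_derivative (\<lambda>X. D' X - D X)) (at (snd c y))"
      unfolding \<sigma>_def o_def
      by (intro derivative_intros D(1)[unfolded o_def] D'(1)[unfolded o_def])
    moreover have "D' X - D X = 0" for X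
      using D(2)[of X] D'(2)[of X] by simp
    ultimately show "((\<sigma> \<circ> chart_inv c) has_derivative (\<lambda>X. 0)) (at (snd c y))"
      by simp
  qed
  then show ?thesis
    by (simp add: \<sigma>_def)
qed

text \<open>If \<open>\<tau>\<close> vanished at a point, the two sphere congruences of the transform would coincide there, and would not
span a contact element.\<close>

lemma isotropic_gauge_section:
  assumes "omega_surface A S" "isotropic_gauge A \<tau> S" "lie_darboux_transform A \<mu> S S'"
    and S': "\<And>x. sph_m S' x = blinfun_apply (op_exp (\<mu> *\<^sub>R \<tau> x)) ` sph_p S' x"
  shows "isotropic_section (\<tau> x) (sph_p S x) (sph_m S x)"
proof -
  have "omega_surface A S'"
    using assms(3) by (simp add: lie_darboux_transform_def)
  note om = omega_surfaceD[OF assms(1)] omega_surfaceD[OF this]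
  have mem: "\<tau> x \<in> wedge_space (sph_p S x) (sph_m S x)"
    using assms(2) by (simp add: isotropic_pair_via_def)
  have "\<tau> x \<noteq> 0"
  proof
    assume "\<tau> x = 0"
    then have "sph_m S' x = sph_p S' x"
      using op_exp_wedge_space[OF om(5,6,8) mem, of \<mu>] by (simp add: S')
    moreover have "space_sum (sph_p S' x) (sph_p S' x) \<subseteq> sph_p S' x"
      using om(14)[of x] unfolding space_sum_def null_subspaces_def by (blast intro: subspace_add)
    ultimately have "dim (space_sum (sph_p S' x) (sph_m S' x)) \<le> dim (sph_p S' x)"
      by (simp add: dim_subset)
    then show False
      using om(14)[of x] om(16)[of x] by (simp add: null_subspaces_def)
  qed
  then show ?thesis
    using om mem by (simp add: isotropic_section_def)
qed

text \<open>Both sides lie in the line of wedges of the transform, by the transport along an edge, and have the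
same differential, by the first order formulas for the four forms.\<close>

lemma isotropic_gauge_transform:
  fixes A :: "('p::{t2_space, second_countable_topology}) chart set"
  assumes A: "smooth_atlas A" and conn: "connected (UNIV :: 'p set)"
    and S: "omega_surface A S" and ldt: "lie_darboux_transform A \<mu> S S'"
    and \<tau>: "isotropic_gauge A \<tau> S"
    and S': "\<And>x. sph_m S' x = blinfun_apply (op_exp (\<mu> *\<^sub>R \<tau> x)) ` sph_p S' x"
    and \<tau>': "isotropic_gauge A \<tau>' S'"
  shows "\<tau>' x = \<tau> x + (1 / \<mu>) *\<^sub>R (nwedge (sph_p S x) (sph_p S' x) - nwedge (sph_m S x) (sph_m S' x))"
proof -
  have S'_omega: "omega_surface A S'"
    and dtp: "darboux_transform A \<mu> (sph_p S) (form_p S) (sph_p S') (form_p S')"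
    and dtm: "darboux_transform A \<mu> (sph_m S) (form_m S) (sph_m S') (form_m S')"
    using ldt by (simp_all add: lie_darboux_transform_def)
  note om = omega_surfaceD[OF S] and om' = omega_surfaceD[OF S'_omega]
  define N where "N = (\<lambda>y. nwedge (sph_p S y) (sph_p S' y) - nwedge (sph_m S y) (sph_m S' y))"
  define \<sigma> where "\<sigma> = (\<lambda>y. \<tau>' y - (\<tau> y + (1 / \<mu>) *\<^sub>R N y))"
  have "\<sigma> x = 0"
  proof (rule isotropic_gauge_unique[OF A conn om'(9,5,6)])
    fix y
    have "isotropic_section (\<tau> y + (1 / \<mu>) *\<^sub>R N y) (sph_p S' y) (sph_m S' y)"
      unfolding N_def
      by (rule isotropic_section_transfer(1)[OF isotropic_gauge_section[OF S \<tau> ldt S'] om'(5) _ _ S'])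
         (use dtp dtm in \<open>auto simp: darboux_transform_def\<close>)
    then show "\<sigma> y \<in> wedge_space (sph_p S' y) (sph_m S' y)"
      using \<tau>' unfolding \<sigma>_def isotropic_section_def isotropic_pair_via_def wedge_space_def
      by (blast intro: span_diff)
  next
    fix c y
    assume c: "c \<in> A" "y \<in> fst c"
    obtain D where D: "((\<tau> \<circ> chart_inv c) has_derivative D) (at (snd c y))"
      "\<And>X. blinfun_apply (form_m S c y) X = blinfun_apply (form_p S c y) X - D X"
      using isotropic_pair_form[OF A c \<tau> om(8)] by blast
    obtain D' where D': "((\<tau>' \<circ> chart_inv c) has_derivative D') (at (snd c y))"
      "\<And>X. blinfun_apply (form_m S' c y) X = blinfun_apply (form_p S' c y) X - D' X"
      using isotropic_pair_form[OF A c \<tau>' om'(8)] by blast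
    obtain Dp where Dp: "((\<lambda>z. nwedge (sph_p S (chart_inv c z)) (sph_p S' (chart_inv c z))) has_derivative Dp)
        (at (snd c y))"
      "\<And>X. blinfun_apply (form_p S' c y) X = blinfun_apply (form_p S c y) X + (1 / \<mu>) *\<^sub>R Dp X"
      using darboux_form[OF A c om(3) dtp] by blast
    obtain Dm where Dm: "((\<lambda>z. nwedge (sph_m S (chart_inv c z)) (sph_m S' (chart_inv c z))) has_derivative Dm)
        (at (snd c y))"
      "\<And>X. blinfun_apply (form_m S' c y) X = blinfun_apply (form_m S c y) X + (1 / \<mu>) *\<^sub>R Dm X"
      using darboux_form[OF A c om(4) dtm] by blast
    have "((\<sigma> \<circ> chart_inv c) has_derivative (\<lambda>X. D' X - (D X + (1 / \<mu>) *\<^sub>R (Dp X - Dm X)))) (at (snd c y))"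
      unfolding \<sigma>_def N_def o_def
      by (intro derivative_intros D(1)[unfolded o_def] D'(1)[unfolded o_def] Dp(1) Dm(1))
    moreover have "D' X - (D X + (1 / \<mu>) *\<^sub>R (Dp X - Dm X)) = 0" for X
    proof -
      have "(1 / \<mu>) *\<^sub>R Dm X - D X = (1 / \<mu>) *\<^sub>R Dp X - D' X"
        using D(2)[of X] D'(2)[of X] Dp(2)[of X] Dm(2)[of X] by simp
      then show ?thesis by (simp add: algebra_simps)
    qed
    ultimately show "((\<sigma> \<circ> chart_inv c) has_derivative (\<lambda>X. 0)) (at (snd c y))"
      by simp
  qed
  then show ?thesis
    by (simp add: \<sigma>_def N_def)
qed

text \<open>The coefficient of \<open>t\<^sup>2\<close> in the parallelity of \<open>p\<^sup>(\<^sup>0\<^sup>) + t p\<^sup>(\<^sup>1\<^sup>)\<close> is \<open>\<eta> p\<^sup>(\<^sup>1\<^sup>) = 0\<close>.  The values of \<open>\<eta>\<close> are wedges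
\<open>u \<and> w\<close> with \<open>u\<close> in \<open>f\<close>, and such a wedge can annihilate a vector that is not orthogonal to \<open>u\<close> only if
it is zero.\<close>

lemma conserved_quantity_orthogonal:
  fixes A :: "('p::{t2_space, second_countable_topology}) chart set"
  assumes A: "smooth_atlas A" and f: "isothermic A f \<eta>"
    and cq: "linear_conserved_quantity A \<eta> p0 p1"
  shows "orthogonal_spaces (f x) {p1 x}"
proof -
  obtain c where c: "c \<in> A" "x \<in> fst c"
    using chart_at[OF A] by blast
  have "f x \<in> lie_quadric"
    using f by (simp add: isothermic_def sphere_congruence_def)
  then obtain u where u: "f x = span {u}" "lie_form u u = 0"
    by (rule lie_quadricE)
  have "(p0 \<circ> chart_inv c) differentiable (at (snd c x))" "(p1 \<circ> chart_inv c) differentiable (at (snd c x))"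
    using cq c by (auto intro: smooth_map_differentiable simp: linear_conserved_quantity_def)
  then obtain D0 D1 where D: "((p0 \<circ> chart_inv c) has_derivative D0) (at (snd c x))"
    "((p1 \<circ> chart_inv c) has_derivative D1) (at (snd c x))"
    unfolding differentiable_def by blast
  have kill: "blinfun_apply (blinfun_apply (\<eta> c x) X) (p1 x) = 0" for X
  proof -
    let ?E = "blinfun_apply (blinfun_apply (\<eta> c x) X)"
    have "D0 X + t *\<^sub>R D1 X + t *\<^sub>R ?E (p0 x + t *\<^sub>R p1 x) = 0" for t
    proof -
      have "(((\<lambda>y. p0 y + t *\<^sub>R p1 y) \<circ> chart_inv c) has_derivative (\<lambda>X. D0 X + t *\<^sub>R D1 X)) (at (snd c x))"
        unfolding o_def by (intro derivative_intros D[unfolded o_def])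
      then have "chart_deriv c (\<lambda>y. p0 y + t *\<^sub>R p1 y) x X = D0 X + t *\<^sub>R D1 X"
        by (simp add: chart_deriv_def frechet_derivative_at[symmetric])
      moreover have "conn \<eta> t (\<lambda>y. p0 y + t *\<^sub>R p1 y) c x X = 0"
        using cq c unfolding linear_conserved_quantity_def by blast
      ultimately show ?thesis
        by (simp add: conn_def)
    qed
    \<comment> \<open>With the value at 0, the values at 1 and -1 isolate the coefficient of \<open>t\<^sup>2\<close>.\<close>
    from this[of 0] this[of 1] this[of "-1"] have "2 *\<^sub>R ?E (p1 x) = 0"
      by (simp add: blinfun.add_right blinfun.diff_right scaleR_2 algebra_simps)
    then show ?thesis by simp
  qed
  have "lie_form u (p1 x) = 0"
  proof (rule ccontr)
    assume nz: "lie_form u (p1 x) \<noteq> 0"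
    have "blinfun_apply (\<eta> c x) X = 0" for X
    proof -
      have "blinfun_apply (\<eta> c x) X \<in> wedge_space (span {u}) (perp (span {u}))"
        using f c unfolding isothermic_def u(1)[symmetric] by blast
      moreover have "wedge_space (span {u}) (perp (span {u})) \<subseteq> range (wedge u)"
        unfolding wedge_space_def
      proof (rule span_minimal)
        show "{wedge v w |v w. v \<in> span {u} \<and> w \<in> perp (span {u})} \<subseteq> range (wedge u)"
        proof clarify
          fix v w :: R42 assume "v \<in> span {u}"
          then obtain k where "v = k *\<^sub>R u" by (auto simp: span_singleton)
          then have "wedge v w = wedge u (k *\<^sub>R w)"
            using wedge_scaleR[of k u 1 w] wedge_scaleR[of 1 u k w] by simp
          then show "wedge v w \<in> range (wedge u)" by simp
        qed
        show "subspace (range (wedge u))"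
        proof (rule linear_subspace_image[OF _ subspace_UNIV])
          show "linear (wedge u)"
            by (rule linearI) (simp_all add: wedge_add_right wedge_scaleR[of 1, simplified])
        qed
      qed
      ultimately obtain w where w: "blinfun_apply (\<eta> c x) X = wedge u w" by blast
      have "lie_form u (p1 x) *\<^sub>R w = lie_form w (p1 x) *\<^sub>R u"
        using kill[of X] by (simp add: w wedge_apply)
      then have "w = (lie_form w (p1 x) / lie_form u (p1 x)) *\<^sub>R u"
        using nz by (metis divide_inverse_commute left_inverse scaleR_one scaleR_scaleR)
      then have "wedge u w = 0"
        using wedge_scaleR[of 1 u _ u] by (metis scaleR_one scaleR_zero_right wedge_self)
      then show ?thesis by (simp add: w)
    qed
    then have "\<eta> c x = 0"
      by (intro blinfun_eqI) simp
    then show False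
      using f c by (simp add: isothermic_def)
  qed
  then show ?thesis
    by (auto simp: u orthogonal_spaces_def span_singleton lie_form_simps)
qed

lemma linear_eq_from_two_values:
  fixes p q p' q' :: "'a::real_vector"
  assumes "\<And>t. t \<noteq> \<mu> \<Longrightarrow> p + t *\<^sub>R q = p' + t *\<^sub>R q'"
  shows "p = p' \<and> q = q'"
proof -
  have a: "p + (\<mu> + 1) *\<^sub>R q = p' + (\<mu> + 1) *\<^sub>R q'" "p + (\<mu> + 2) *\<^sub>R q = p' + (\<mu> + 2) *\<^sub>R q'"
    by (rule assms; simp)+
  have "p + (\<mu> + 2) *\<^sub>R q - (p + (\<mu> + 1) *\<^sub>R q) = q" for p q :: 'a
    by (simp add: scaleR_add_left scaleR_2)
  from this[of p q] this[of p' q'] a have "q = q'" by simp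
  with a(1) show ?thesis by simp
qed

text \<open>The transformed quantity is prescribed for \<open>t \<noteq> \<mu>\<close>, and a linear polynomial is determined by these
values.\<close>

lemma eisenhart_conserved_quantity:
  assumes S: "omega_surface A S" and E: "eisenhart_transform A \<mu> S S'"
    and q: "orthogonal_spaces (sph_p S x) {cq1 S x}"
  shows "cq0 S' x = cq0 S x"
    and "cq1 S' x = cq1 S x - (1 / \<mu>) *\<^sub>R blinfun_apply (nwedge (sph_p S x) (sph_p S' x)) (cq0 S x)"
    and "orthogonal_spaces (sph_p S' x) {cq1 S' x}"
proof -
  have S': "omega_surface A S'"
    and dt: "darboux_transform A \<mu> (sph_p S) (form_p S) (sph_p S') (form_p S')"
    and inc: "orthogonal_spaces {cq0 S x + \<mu> *\<^sub>R cq1 S x} (sph_p S' x)"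
    and boost: "\<And>t. t \<noteq> \<mu> \<Longrightarrow> cq0 S' x + t *\<^sub>R cq1 S' x =
      blinfun_apply (boost (sph_p S x) (sph_p S' x) (1 - t / \<mu>)) (cq0 S x + t *\<^sub>R cq1 S x)"
    using E by (simp_all add: eisenhart_transform_def lie_darboux_transform_def cq_def)
  have "\<not> orthogonal_spaces (sph_p S x) (sph_p S' x)" "\<mu> \<noteq> 0"
    using dt by (simp_all add: darboux_transform_def)
  note transfer = conserved_quantity_transfer[OF omega_surfaceD(5)[OF S] omega_surfaceD(5)[OF S'] this q inc]
  have "cq0 S' x + t *\<^sub>R cq1 S' x = cq0 S x + t *\<^sub>R
      (cq1 S x - (1 / \<mu>) *\<^sub>R blinfun_apply (nwedge (sph_p S x) (sph_p S' x)) (cq0 S x))"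
    if "t \<noteq> \<mu>" for t
    using boost[OF that] transfer(3)[OF that] by simp
  then show *: "cq0 S' x = cq0 S x"
    "cq1 S' x = cq1 S x - (1 / \<mu>) *\<^sub>R blinfun_apply (nwedge (sph_p S x) (sph_p S' x)) (cq0 S x)"
    using linear_eq_from_two_values by blast+
  show "orthogonal_spaces (sph_p S' x) {cq1 S' x}"
    unfolding * by (rule transfer(1))
qed

text \<open>Everything the lattice construction needs to know about an axis, expressed by the partial sums \<open>P\<close>, \<open>M\<close>
of \<open>N / m\<close> and by the data at the origin alone; so the two axes can be combined.\<close>

lemma eisenhart_chain:
  fixes A :: "('p::{t2_space, second_countable_topology}) chart set"
  assumes A: "smooth_atlas A" and conn: "connected (UNIV :: 'p set)"
    and S: "guichard_surface A (H 0)" and E: "\<And>m. eisenhart_transform A (\<alpha> m) (H m) (H (Suc m))"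
    and \<tau>\<^sub>0: "isotropic_gauge A \<tau>\<^sub>0 (H 0)"
    and P: "\<And>m. P m = (\<Sum>i<m. (1 / \<alpha> i) *\<^sub>R nwedge (sph_p (H i) x) (sph_p (H (Suc i)) x))"
    and M: "\<And>m. M m = (\<Sum>i<m. (1 / \<alpha> i) *\<^sub>R nwedge (sph_m (H i) x) (sph_m (H (Suc i)) x))"
  shows "\<alpha> m \<noteq> 0" and "sph_p (H m) x \<in> lie_quadric" and "sph_m (H m) x \<in> lie_quadric"
    and "isotropic_section (\<tau>\<^sub>0 x) (sph_p (H 0) x) (sph_m (H 0) x)"
    and "sph_m (H (Suc m)) x =
      blinfun_apply (op_exp (\<alpha> m *\<^sub>R (\<tau>\<^sub>0 x + P m - M m))) ` sph_p (H (Suc m)) x"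
    and "orthogonal_spaces {cq0 (H 0) x + \<alpha> m *\<^sub>R (cq1 (H 0) x - blinfun_apply (P m) (cq0 (H 0) x))}
      (sph_p (H (Suc m)) x)"
proof -
  have ldt: "lie_darboux_transform A (\<alpha> m) (H m) (H (Suc m))" for m
    using E by (simp add: eisenhart_transform_def)
  have om: "omega_surface A (H m)" for m
    using S ldt by (cases m) (auto simp: guichard_surface_def lie_darboux_transform_def)
  show "\<alpha> m \<noteq> 0"
    using ldt[of m] by (simp add: lie_darboux_transform_def darboux_transform_def)
  show "sph_p (H m) x \<in> lie_quadric" "sph_m (H m) x \<in> lie_quadric"
    using om by (rule omega_surfaceD)+
  have "\<exists>\<tau>. isotropic_gauge A \<tau> (H m) \<and>
      (\<forall>x. sph_m (H (Suc m)) x = blinfun_apply (op_exp (\<alpha> m *\<^sub>R \<tau> x)) ` sph_p (H (Suc m)) x)" for m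
    using ldt[of m] by (simp add: lie_darboux_transform_def)
  then obtain T where T: "\<And>m. isotropic_gauge A (T m) (H m)"
    "\<And>m x. sph_m (H (Suc m)) x = blinfun_apply (op_exp (\<alpha> m *\<^sub>R T m x)) ` sph_p (H (Suc m)) x"
    by metis
  have "T 0 x = \<tau>\<^sub>0 x"
    by (rule isotropic_gauge_determined[OF A conn om \<tau>\<^sub>0 T(1)])
  moreover have "T (Suc m) x = T m x + (1 / \<alpha> m) *\<^sub>R (nwedge (sph_p (H m) x) (sph_p (H (Suc m)) x)
      - nwedge (sph_m (H m) x) (sph_m (H (Suc m)) x))" for m
    by (rule isotropic_gauge_transform[OF A conn om ldt T(1) T(2) T(1)])
  ultimately have T_eq: "T m x = \<tau>\<^sub>0 x + P m - M m" for m
    by (induction m) (simp_all add: P M scaleR_diff_right)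
  show "isotropic_section (\<tau>\<^sub>0 x) (sph_p (H 0) x) (sph_m (H 0) x)"
    using isotropic_gauge_section[OF om T(1) ldt T(2), of 0 x] by (simp add: T_eq P M)
  show "sph_m (H (Suc m)) x =
      blinfun_apply (op_exp (\<alpha> m *\<^sub>R (\<tau>\<^sub>0 x + P m - M m))) ` sph_p (H (Suc m)) x"
    using T(2) by (simp add: T_eq)
  have cq: "cq0 (H m) x = cq0 (H 0) x \<and> cq1 (H m) x = cq1 (H 0) x - blinfun_apply (P m) (cq0 (H 0) x) \<and>
      orthogonal_spaces (sph_p (H m) x) {cq1 (H m) x}" for m
  proof (induction m)
    case 0
    have "orthogonal_spaces (sph_p (H 0) x) {cq1 (H 0) x}"
      using S conserved_quantity_orthogonal[OF A omega_surfaceD(1)[OF om], of 0 "cq0 (H 0)"]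
      by (simp add: guichard_surface_def)
    then show ?case by (simp add: P)
  next
    case (Suc m)
    note e = eisenhart_conserved_quantity[OF om E Suc[THEN conjunct2, THEN conjunct2]]
    show ?case
      using Suc e by (simp add: P blinfun.add_left blinfun.scaleR_left)
  qed
  show "orthogonal_spaces {cq0 (H 0) x + \<alpha> m *\<^sub>R (cq1 (H 0) x - blinfun_apply (P m) (cq0 (H 0) x))}
      (sph_p (H (Suc m)) x)"
  proof -
    have "orthogonal_spaces {cq (H m) (\<alpha> m) x} (sph_p (H (Suc m)) x)"
      using E[of m] by (simp add: eisenhart_transform_def)
    then show ?thesis
      using cq[of m] by (simp add: cq_def)
  qed
qed

theorem corollary3p4:
  fixes A :: "('p::{t2_space, second_countable_topology}) chart set"
    and \<Lambda>\<^sub>0 :: "'p surface_data"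
    and fp fm :: "nat \<Rightarrow> nat \<Rightarrow> 'p \<Rightarrow> R42 set"
    and \<alpha> \<beta> :: "nat \<Rightarrow> real"
    and x :: 'p
  assumes "smooth_atlas A" and "simply_connected (UNIV :: 'p set)"
    and "guichard_surface A \<Lambda>\<^sub>0"
    and "eisenhart_lattice A \<alpha> \<beta> \<Lambda>\<^sub>0 fp fm"
  shows "discrete_guichard_surface (\<lambda>m n. space_sum (fp m n x) (fm m n x))"
proof -
  have conn: "connected (UNIV :: 'p set)"
    using assms(2) by (rule simply_connected_space_imp_connected)
  obtain H V where base: "H 0 = \<Lambda>\<^sub>0" "V 0 = \<Lambda>\<^sub>0"
    and H: "\<And>m. eisenhart_transform A (\<alpha> m) (H m) (H (Suc m))"
    and V: "\<And>n. eisenhart_transform A (\<beta> n) (V n) (V (Suc n))"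
    and axis_h: "\<And>m. fp m 0 = sph_p (H m)" "\<And>m. fm m 0 = sph_m (H m)"
    and axis_v: "\<And>n. fp 0 n = sph_p (V n)" "\<And>n. fm 0 n = sph_m (V n)"
    and ne: "\<And>m n. \<alpha> m \<noteq> \<beta> n"
    and bl: "bianchi_lattice \<alpha> \<beta> fp" "bianchi_lattice \<alpha> \<beta> fm"
    using assms(4) unfolding eisenhart_lattice_def by blast
  obtain \<tau> where \<tau>: "isotropic_gauge A \<tau> \<Lambda>\<^sub>0"
    using assms(3) by (auto simp: guichard_surface_def omega_surface_def)
  obtain r s where rs: "r \<noteq> 0" "s \<noteq> 0" "\<And>t. lie_form (cq \<Lambda>\<^sub>0 t x) (cq \<Lambda>\<^sub>0 t x) = r + s * t"
    using assms(3) unfolding guichard_surface_def by blast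
  have G: "guichard_surface A (H 0)" "guichard_surface A (V 0)"
    and \<tau>': "isotropic_gauge A \<tau> (H 0)" "isotropic_gauge A \<tau> (V 0)"
    using assms(3) \<tau> by (simp_all add: base)
  note chain_h = eisenhart_chain[where H = H and \<alpha> = \<alpha> and x = x, OF assms(1) conn G(1) H \<tau>'(1) refl refl,
      folded axis_h, unfolded base]
  note chain_v = eisenhart_chain[where H = V and \<alpha> = \<beta> and x = x, OF assms(1) conn G(2) V \<tau>'(2) refl refl,
      folded axis_v, unfolded base]
  interpret plus: bianchi_net \<alpha> \<beta> "\<lambda>m n. fp m n x"
    by unfold_locales (use chain_h(1,2) chain_v(1,2) ne bl in \<open>auto simp: bianchi_lattice_def\<close>)
  interpret minus: bianchi_net \<alpha> \<beta> "\<lambda>m n. fm m n x"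
    by unfold_locales (use chain_h(1,3) chain_v(1,3) ne bl in \<open>auto simp: bianchi_lattice_def\<close>)
  have pot: "plus.potential m 0 = (\<Sum>i<m. (1 / \<alpha> i) *\<^sub>R nwedge (fp i 0 x) (fp (Suc i) 0 x))"
    "minus.potential m 0 = (\<Sum>i<m. (1 / \<alpha> i) *\<^sub>R nwedge (fm i 0 x) (fm (Suc i) 0 x))"
    "plus.potential 0 n = (\<Sum>i<n. (1 / \<beta> i) *\<^sub>R nwedge (fp 0 i x) (fp 0 (Suc i) x))"
    "minus.potential 0 n = (\<Sum>i<n. (1 / \<beta> i) *\<^sub>R nwedge (fm 0 i x) (fm 0 (Suc i) x))" for m n
    by (simp_all add: plus.potential_def minus.potential_def)
  interpret isotropic_nets \<alpha> \<beta> "\<lambda>m n. fp m n x" "\<lambda>m n. fm m n x" "\<tau> x"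
      "\<lambda>m n. \<tau> x + plus.potential m n - minus.potential m n"
  proof unfold_locales
    show "isotropic_section (\<tau> x) (fp 0 0 x) (fm 0 0 x)"
      by (rule chain_h(4))
    show "fm (Suc m) 0 x = blinfun_apply (op_exp (\<alpha> m *\<^sub>R (\<tau> x + plus.potential m 0 - minus.potential m 0))) `
        fp (Suc m) 0 x" for m
      unfolding pot by (rule chain_h(5))
    show "fm 0 (Suc n) x = blinfun_apply (op_exp (\<beta> n *\<^sub>R (\<tau> x + plus.potential 0 n - minus.potential 0 n))) `
        fp 0 (Suc n) x" for n
      unfolding pot by (rule chain_v(5))
  qed simp_all
  have "guichard_quantity_for (\<lambda>m n. \<alpha> m) (\<lambda>m n. \<beta> n) (\<lambda>m n. fp m n x)"
  proof (rule plus.guichard_quantity)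
    have "orthogonal_spaces (sph_p \<Lambda>\<^sub>0 x) {cq1 \<Lambda>\<^sub>0 x}"
      using assms(3) unfolding guichard_surface_def
      by (blast intro: conserved_quantity_orthogonal[OF assms(1)] omega_surfaceD)
    then show "orthogonal_spaces (fp 0 0 x) {cq1 \<Lambda>\<^sub>0 x}"
      by (simp add: axis_h base)
    show "orthogonal_spaces {cq0 \<Lambda>\<^sub>0 x + \<alpha> m *\<^sub>R (cq1 \<Lambda>\<^sub>0 x - blinfun_apply (plus.potential m 0) (cq0 \<Lambda>\<^sub>0 x))}
        (fp (Suc m) 0 x)" for m
      unfolding pot by (rule chain_h(6))
    show "orthogonal_spaces {cq0 \<Lambda>\<^sub>0 x + \<beta> n *\<^sub>R (cq1 \<Lambda>\<^sub>0 x - blinfun_apply (plus.potential 0 n) (cq0 \<Lambda>\<^sub>0 x))}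
        (fp 0 (Suc n) x)" for n
      unfolding pot by (rule chain_v(6))
    show "lie_form (cq0 \<Lambda>\<^sub>0 x + t *\<^sub>R cq1 \<Lambda>\<^sub>0 x) (cq0 \<Lambda>\<^sub>0 x + t *\<^sub>R cq1 \<Lambda>\<^sub>0 x) = r + s * t" for t
      using rs(3) by (simp add: cq_def)
  qed (fact rs)+
  then show ?thesis
    unfolding discrete_guichard_surface_def using discrete_omega_surface by blast
qed

end
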